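(* Let $\varphi$ be the Laplace transform of a probability distribution on $[0,\infty)$. Let $j\ge0$ and $m\ge1$ be integers and, for $\theta>0$, let $N_\theta$ be a non-negative integer-valued random variable with probability generating function $P_\theta(s)=s^{j}\varphi\{(1-s^{m})/\theta\}$. (a) Suppose that for each $\theta>0$, $X_{\theta,1},X_{\theta,2},\dots$ are i.i.d. real random variables independent of $N_\theta$ such that $\sum_{i=1}^{[1/\theta]}X_{\theta,i}$ converges in distribution as $\theta\to0$. If $\sum_{i=1}^{N_\theta}X_{\theta,i}$ converges in distribution to $Z$ as $\theta\to0$, then the law of $Z$ is $\varphi$-ID. (b) Conversely, for every $\varphi$-ID law and every choice of integers $j\ge0$, $m\ge1$, there exist, for each $\theta>0$, i.i.d. real random variables $X_{\theta,1},X_{\theta,2},\dots$ independent of $N_\theta$, with $\sum_{i=1}^{[1/\theta]}X_{\theta,i}$ convergent in distribution as $\theta\to0$, such that $\sum_{i=1}^{N_\theta}X_{\theta,i}$ converges in distribution to the given law as $\theta\to0$.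
   Context: $\varphi(s)=E(e^{-sU})$ for a non-negative random variable $U$, used for all complex $s$ with $\operatorname{Re}s\ge 0$. $[x]$ denotes the integer part of $x$. For each $\theta>0$ and integers $j\ge0$, $m\ge1$, the function $s^{j}\varphi\{(1-s^{m})/\theta\}$, $0<s<1$, is a probability generating function. A law is called $\varphi$-ID if its characteristic function $f$ is $\varphi$-ID, that is, if there are positive constants $a_n$ and characteristic functions $f_n$ ($n\ge1$) such that $f(t)=\lim_{n\to\infty}\varphi\{a_n(1-f_n(t))\}$ for all $t\in\mathbf{R}$. *)

theory Defs
  imports "HOL-Probability.Probability"
begin

definition laplace :: "real measure \<Rightarrow> complex \<Rightarrow> complex" where
  "laplace \<mu> s = (CLINT u|\<mu>. exp (- (s * complex_of_real u)))"

text \<open>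
  Here \<open>\<phi>\<close> is only ever evaluated in the closed right half plane, since
  the real part of a characteristic function is at most 1.
\<close>
definition phi_ID :: "(complex \<Rightarrow> complex) \<Rightarrow> (real \<Rightarrow> complex) \<Rightarrow> bool" where
  "phi_ID \<phi> f \<longleftrightarrow>
     (\<exists>(a :: nat \<Rightarrow> real) (F :: nat \<Rightarrow> real measure).
        (\<forall>n. 0 < a n) \<and> (\<forall>n. real_distribution (F n)) \<and>
        (\<forall>t. (\<lambda>n. \<phi> (complex_of_real (a n) * (1 - char (F n) t))) \<longlonglongrightarrow> f t))"

definition phi_ID_law :: "(complex \<Rightarrow> complex) \<Rightarrow> real measure \<Rightarrow> bool" where
  "phi_ID_law \<phi> L \<longleftrightarrow> real_distribution L \<and> phi_ID \<phi> (char L)"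

definition pgf :: "'a measure \<Rightarrow> ('a \<Rightarrow> nat) \<Rightarrow> real \<Rightarrow> real" where
  "pgf M N s = (\<integral>\<omega>. s ^ N \<omega> \<partial>M)"

text \<open>
  The counterpart of \<^const>\<open>weak_conv_m\<close> for families indexed by the positive
  reals, as the index tends to 0. Only the random variables with positive index matter.
\<close>
definition tends_in_law_at_0 ::
    "(real \<Rightarrow> 'a measure) \<Rightarrow> (real \<Rightarrow> 'a \<Rightarrow> real) \<Rightarrow> real measure \<Rightarrow> bool" where
  "tends_in_law_at_0 M Y L \<longleftrightarrow> real_distribution L \<and>
     (\<forall>x. isCont (cdf L) x \<longrightarrow>
        ((\<lambda>\<theta>. cdf (distr (M \<theta>) borel (Y \<theta>)) x) \<longlongrightarrow> cdf L x) (at_right 0))"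

text \<open>
  \<open>X 1, X 2, \<dots>\<close> are i.i.d. and the sequence is independent of \<open>N\<close>; the value \<open>X 0\<close>
  is never used. Since \<^const>\<open>prob_space.indep_var\<close> requires both variables to have
  the same value type, independence is stated for the generated \<open>\<sigma>\<close>-algebras.
\<close>
definition iid_indep_of :: "'a measure \<Rightarrow> ('a \<Rightarrow> nat) \<Rightarrow> (nat \<Rightarrow> 'a \<Rightarrow> real) \<Rightarrow> bool" where
  "iid_indep_of M N X \<longleftrightarrow>
     prob_space.indep_vars M (\<lambda>_. borel) X {1..} \<and>
     (\<forall>i\<ge>1. distr M borel (X i) = distr M borel (X 1)) \<and>
     prob_space.indep_set M
       {N -` A \<inter> space M | A. A \<in> sets (count_space UNIV)}
       {(\<lambda>\<omega>. \<lambda>i\<in>{1..}. X i \<omega>) -` B \<inter> space M | B. B \<in> sets (PiM {1..} (\<lambda>_. borel))}"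

end

theory Submission
  imports Defs "HOL-Complex_Analysis.Cauchy_Integral_Formula"
begin

text \<open>
  Let \<open>g\<^sub>\<theta>\<close> be the characteristic function of \<open>X\<^sub>\<theta>\<^sub>,\<^sub>1\<close>. Comparing power series coefficients extends the
  formula for the generating function of \<open>N\<^sub>\<theta>\<close> to the closed complex unit disc, so the random sum has
  characteristic function \<open>g\<^sub>\<theta>\<^sup>j \<phi>((1 - g\<^sub>\<theta>\<^sup>m) / \<theta>)\<close>.

  (a) Convergence of \<open>g\<^sub>\<theta>\<close> to the power \<open>[1/\<theta>]\<close> forces \<open>g\<^sub>\<theta> \<rightarrow> 1\<close>, so the factor \<open>g\<^sub>\<theta>\<^sup>j\<close> disappears in the
  limit; along \<open>\<theta> = 1/n\<close> one reads off \<open>a\<^sub>n = n\<close> and \<open>f\<^sub>n = g\<^sub>1\<^sub>/\<^sub>n\<^sup>m\<close>.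

  (b) Put \<open>\<psi>\<^sub>n = a\<^sub>n (1 - f\<^sub>n)\<close>. Each \<open>\<phi>(\<psi>\<^sub>n)\<close> is the characteristic function of a mixed compound Poisson
  law, so these functions are equicontinuous at 0. Unless \<open>U = 0\<close> almost surely, the same
  follows for \<open>\<psi>\<^sub>n\<close>, and the compound Poisson laws with characteristic functions \<open>exp (- \<psi>\<^sub>n / m)\<close> are
  tight. Along a subsequence converging to some \<open>K\<close>, let \<open>n = n(\<theta>)\<close> tend to infinity
  so slowly that \<open>\<theta> a\<^sub>n\<^sup>2 \<rightarrow> 0\<close>, and take \<open>g\<^sub>\<theta> = exp (- \<theta> \<psi>\<^sub>n / m)\<close>. Then the non-random sums tend to \<open>K\<close>
  and \<open>(1 - g\<^sub>\<theta>\<^sup>m) / \<theta>\<close> is asymptotically \<open>\<psi>\<^sub>n\<close>.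
\<close>

section \<open>Random sums of i.i.d. variables\<close>

text \<open>Splits an integral along the values of \<open>N\<close>, by dominated convergence for
  the truncations to \<open>N \<omega> < k\<close>. Letting \<open>f n\<close> depend on
  \<open>\<omega>\<close> covers both the powers \<open>z ^ N \<omega>\<close> and the exponential
  of a random sum.\<close>

lemma (in prob_space) sums_integral_nat_valued:
  fixes f :: "nat \<Rightarrow> 'a \<Rightarrow> complex"
  assumes N[measurable]: "N \<in> measurable M (count_space UNIV)"
    and f[measurable]: "\<And>n. f n \<in> borel_measurable M"
    and bd: "\<And>n \<omega>. norm (f n \<omega>) \<le> B"
  shows "(\<lambda>n. \<integral>\<omega>. indicator {n} (N \<omega>) * f n \<omega> \<partial>M) sums (\<integral>\<omega>. f (N \<omega>) \<omega> \<partial>M)"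
proof -
  have B: "0 \<le> B"
    using order_trans[OF norm_ge_zero bd] .
  let ?h = "\<lambda>k \<omega>. if N \<omega> < k then f (N \<omega>) \<omega> else 0"
  have eq: "(\<Sum>n<k. \<integral>\<omega>. indicator {n} (N \<omega>) * f n \<omega> \<partial>M) = (\<integral>\<omega>. ?h k \<omega> \<partial>M)" for k
  proof -
    have "(\<Sum>n<k. indicator {n} (N \<omega>) * f n \<omega>) = ?h k \<omega>" for \<omega>
    proof -
      have "(\<Sum>n<k. indicator {n} (N \<omega>) * f n \<omega>) = (\<Sum>n<k. if n = N \<omega> then f n \<omega> else 0)"
        by (intro sum.cong) (auto simp: indicator_def)
      then show ?thesis
        by (simp add: sum.delta)
    qed
    moreover have "integrable M (\<lambda>\<omega>. indicator {n} (N \<omega>) * f n \<omega>)" for n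
      by (rule integrable_const_bound[where B = B]) (use bd B in \<open>auto simp: indicator_def\<close>)
    ultimately show ?thesis
      by (subst Bochner_Integration.integral_sum[symmetric]) auto
  qed
  have "(\<lambda>k. \<integral>\<omega>. ?h k \<omega> \<partial>M) \<longlonglongrightarrow> (\<integral>\<omega>. f (N \<omega>) \<omega> \<partial>M)"
  proof (rule integral_dominated_convergence[where w = "\<lambda>_. B"])
    show "AE \<omega> in M. (\<lambda>k. ?h k \<omega>) \<longlonglongrightarrow> f (N \<omega>) \<omega>"
    proof (rule AE_I2, rule tendsto_eventually)
      fix \<omega>
      show "\<forall>\<^sub>F k in sequentially. ?h k \<omega> = f (N \<omega>) \<omega>"
        using eventually_gt_at_top[of "N \<omega>"] by eventually_elim auto
    qed
    show "AE \<omega> in M. norm (?h k \<omega>) \<le> B" for k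
      by (rule AE_I2) (use bd B in auto)
  qed auto
  then show ?thesis
    by (simp add: sums_def eq)
qed

text \<open>Bridges from independence of preimage families, where the two value types may differ, to
  \<open>indep_var\<close>, for which the product formula for integrals is available. Composing with
  \<open>g\<close> and \<open>h\<close> only shrinks the families, and they are stable under
  intersection, so independence passes to the generated \<sigma>-algebras.\<close>

lemma (in prob_space) indep_var_of_indep_preimages:
  assumes N: "N \<in> measurable M S" and X: "X \<in> measurable M T"
    and ind: "indep_set {N -` A \<inter> space M | A. A \<in> sets S} {X -` B \<inter> space M | B. B \<in> sets T}"
    and g: "g \<in> measurable S S'" and h: "h \<in> measurable T T'"
  shows "indep_var S' (\<lambda>\<omega>. g (N \<omega>)) T' (\<lambda>\<omega>. h (X \<omega>))"
proof -
  have stable: "Int_stable {f -` A \<inter> space M | A. A \<in> sets R}"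
    if "f \<in> measurable M R" for f :: "'a \<Rightarrow> 'r" and R
  proof (rule Int_stableI, safe)
    fix A B assume "A \<in> sets R" "B \<in> sets R"
    then show "\<exists>C. f -` A \<inter> space M \<inter> (f -` B \<inter> space M) = f -` C \<inter> space M \<and> C \<in> sets R"
      by (intro exI[of _ "A \<inter> B"]) auto
  qed
  have gN: "(\<lambda>\<omega>. g (N \<omega>)) \<in> measurable M S'" and hX: "(\<lambda>\<omega>. h (X \<omega>)) \<in> measurable M T'"
    using measurable_compose[OF N g] measurable_compose[OF X h] by auto
  have subN: "{(\<lambda>\<omega>. g (N \<omega>)) -` A \<inter> space M | A. A \<in> sets S'} \<subseteq> {N -` A \<inter> space M | A. A \<in> sets S}"
  proof safe
    fix A assume "A \<in> sets S'"
    then show "\<exists>B. (\<lambda>\<omega>. g (N \<omega>)) -` A \<inter> space M = N -` B \<inter> space M \<and> B \<in> sets S"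
      using measurable_space[OF N] by (intro exI[of _ "g -` A \<inter> space S"]) (auto intro: measurable_sets[OF g])
  qed
  have subX: "{(\<lambda>\<omega>. h (X \<omega>)) -` A \<inter> space M | A. A \<in> sets T'} \<subseteq> {X -` A \<inter> space M | A. A \<in> sets T}"
  proof safe
    fix A assume "A \<in> sets T'"
    then show "\<exists>B. (\<lambda>\<omega>. h (X \<omega>)) -` A \<inter> space M = X -` B \<inter> space M \<and> B \<in> sets T"
      using measurable_space[OF X] by (intro exI[of _ "h -` A \<inter> space T"]) (auto intro: measurable_sets[OF h])
  qed
  have mono: "indep_set A' B'" if "indep_set A B" "A' \<subseteq> A" "B' \<subseteq> B" for A A' B B'
    using that unfolding indep_sets2_eq by blast
  have "indep_set {(\<lambda>\<omega>. g (N \<omega>)) -` A \<inter> space M | A. A \<in> sets S'}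
                  {(\<lambda>\<omega>. h (X \<omega>)) -` A \<inter> space M | A. A \<in> sets T'}"
    by (rule mono[OF ind subN subX])
  then show ?thesis
    unfolding indep_var_eq
    by (intro conjI indep_set_sigma_sets stable gN hX)
qed

lemma iid_indep_of_measurable:
  assumes "prob_space M" "iid_indep_of M N X" "1 \<le> i"
  shows "X i \<in> borel_measurable M"
  using assms unfolding iid_indep_of_def
  by (auto simp: prob_space.indep_vars_def[OF assms(1)])

lemma iid_indep_of_measurable_sum:
  assumes "prob_space M" "iid_indep_of M N X"
  shows "(\<lambda>\<omega>. \<Sum>i = 1..n. X i \<omega>) \<in> borel_measurable M"
  using iid_indep_of_measurable[OF assms] by (intro borel_measurable_sum) auto

lemma iid_indep_of_measurable_random_sum:
  assumes "prob_space M" "iid_indep_of M N X" and "N \<in> measurable M (count_space UNIV)"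
  shows "(\<lambda>\<omega>. \<Sum>i = 1..N \<omega>. X i \<omega>) \<in> borel_measurable M"
  using iid_indep_of_measurable_sum[OF assms(1,2)] assms(3)
  by (rule measurable_compose_countable)

lemma char_iid_sum:
  assumes "prob_space M" "iid_indep_of M N X"
  shows "char (distr M borel (\<lambda>\<omega>. \<Sum>i = 1..n. X i \<omega>)) t = char (distr M borel (X 1)) t ^ n"
proof -
  interpret prob_space M by fact
  have "indep_vars (\<lambda>_. borel) X {1..n}"
    using assms(2) unfolding iid_indep_of_def by (auto intro: indep_vars_subset)
  then have "char (distr M borel (\<lambda>\<omega>. \<Sum>i = 1..n. X i \<omega>)) t = (\<Prod>i = 1..n. char (distr M borel (X i)) t)"
    by (rule char_distr_sum)
  also have "\<dots> = (\<Prod>i = 1..n. char (distr M borel (X 1)) t)"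
    using assms(2) unfolding iid_indep_of_def
    by (intro prod.cong refl arg_cong[where f = "\<lambda>F. char F t"]) (meson atLeastAtMost_iff)
  finally show ?thesis
    by simp
qed

text \<open>On the event \<open>N = n\<close> the sum has \<open>n\<close> terms, and independence
  integrates its exponential separately from the event, giving a factor \<open>?z ^ n\<close>. Both
  sides are then the same series over \<open>n\<close>.\<close>

lemma char_random_sum:
  assumes M: "prob_space M" and iid: "iid_indep_of M N X"
    and N[measurable]: "N \<in> measurable M (count_space UNIV)"
  shows "char (distr M borel (\<lambda>\<omega>. \<Sum>i = 1..N \<omega>. X i \<omega>)) t = (\<integral>\<omega>. char (distr M borel (X 1)) t ^ N \<omega> \<partial>M)"
proof -
  interpret prob_space M by fact
  let ?z = "char (distr M borel (X 1)) t"
  let ?Xr = "\<lambda>\<omega>. \<lambda>i\<in>{1..}. X i \<omega>"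
  let ?h = "\<lambda>n (x :: nat \<Rightarrow> real). iexp (t * (\<Sum>i = 1..n. x i))"
  have X1: "real_distribution (distr M borel (X 1))"
    using iid_indep_of_measurable[OF M iid, of 1] by simp
  have [measurable]: "X i \<in> borel_measurable M" if "1 \<le> i" for i
    using iid_indep_of_measurable[OF M iid that] .
  have Xr[measurable]: "?Xr \<in> measurable M (PiM {1..} (\<lambda>_. borel))"
    by (rule measurable_restrict) auto
  have [measurable]: "(\<lambda>\<omega>. \<Sum>i = 1..n. X i \<omega>) \<in> borel_measurable M" for n
    by (rule iid_indep_of_measurable_sum[OF M iid])
  have h[measurable]: "?h n \<in> borel_measurable (PiM {1..} (\<lambda>_. borel))" for n
  proof -
    have "(\<lambda>x :: nat \<Rightarrow> real. \<Sum>i = 1..n. x i) \<in> borel_measurable (PiM {1..} (\<lambda>_. borel))"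
      by (intro borel_measurable_sum measurable_component_singleton) auto
    then show ?thesis by measurable
  qed
  have summand: "(\<integral>\<omega>. indicator {n} (N \<omega>) * iexp (t * (\<Sum>i = 1..n. X i \<omega>)) \<partial>M) =
    (\<integral>\<omega>. indicator {n} (N \<omega>) * ?z ^ n \<partial>M)" for n
  proof -
    \<comment> \<open>The indicator is taken complex-valued so that both variables have the same
      type, and the exponential is written as a function of the whole restricted sequence
      \<open>?Xr\<close>, to match the form of \<open>iid_indep_of\<close>.\<close>
    have "indep_var borel (\<lambda>\<omega>. indicator {n} (N \<omega>) :: complex) borel (\<lambda>\<omega>. ?h n (?Xr \<omega>))"
      by (rule indep_var_of_indep_preimages[OF N Xr _ _ h])
         (use iid in \<open>simp_all only: iid_indep_of_def\<close>, simp)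
    moreover have "?h n (?Xr \<omega>) = iexp (t * (\<Sum>i = 1..n. X i \<omega>))" for \<omega>
      by simp
    ultimately have "indep_var borel (\<lambda>\<omega>. indicator {n} (N \<omega>) :: complex) borel (\<lambda>\<omega>. iexp (t * (\<Sum>i = 1..n. X i \<omega>)))"
      by simp
    then have "(\<integral>\<omega>. indicator {n} (N \<omega>) * iexp (t * (\<Sum>i = 1..n. X i \<omega>)) \<partial>M) =
      (\<integral>\<omega>. indicator {n} (N \<omega>) \<partial>M) * (\<integral>\<omega>. iexp (t * (\<Sum>i = 1..n. X i \<omega>)) \<partial>M)"
    proof (rule indep_var_lebesgue_integral)
      show "integrable M (\<lambda>\<omega>. indicator {n} (N \<omega>) :: complex)"
        by (rule integrable_const_bound[where B = 1]) (simp_all add: indicator_def)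
      show "integrable M (\<lambda>\<omega>. iexp (t * (\<Sum>i = 1..n. X i \<omega>)))"
        by (rule integrable_const_bound[where B = 1]) simp_all
    qed
    also have "(\<integral>\<omega>. iexp (t * (\<Sum>i = 1..n. X i \<omega>)) \<partial>M) = char (distr M borel (\<lambda>\<omega>. \<Sum>i = 1..n. X i \<omega>)) t"
      by (simp add: char_def integral_distr)
    also have "\<dots> = ?z ^ n"
      by (rule char_iid_sum[OF M iid])
    finally show ?thesis
      by simp
  qed
  have "(\<lambda>n. \<integral>\<omega>. indicator {n} (N \<omega>) * iexp (t * (\<Sum>i = 1..n. X i \<omega>)) \<partial>M) sums
    (\<integral>\<omega>. iexp (t * (\<Sum>i = 1..N \<omega>. X i \<omega>)) \<partial>M)"
    by (rule sums_integral_nat_valued[OF N, where B = 1]) auto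
  moreover have "(\<lambda>n. \<integral>\<omega>. indicator {n} (N \<omega>) * ?z ^ n \<partial>M) sums (\<integral>\<omega>. ?z ^ N \<omega> \<partial>M)"
    using real_distribution.cmod_char_le_1[OF X1]
    by (intro sums_integral_nat_valued[OF N, where B = 1]) (auto simp: norm_power power_le_one)
  ultimately have "(\<integral>\<omega>. iexp (t * (\<Sum>i = 1..N \<omega>. X i \<omega>)) \<partial>M) = (\<integral>\<omega>. ?z ^ N \<omega> \<partial>M)"
    unfolding summand by (rule sums_unique2)
  moreover have "(\<lambda>\<omega>. \<Sum>i = 1..N \<omega>. X i \<omega>) \<in> borel_measurable M"
    by (rule iid_indep_of_measurable_random_sum[OF M iid N])
  ultimately show ?thesis
    by (simp add: char_def integral_distr)
qed

section \<open>Adjoining an independent i.i.d. sequence by a product space\<close>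

text \<open>Used twice: to build compound Poisson laws, and to attach the summands to the given
  \<open>N\<close> in the converse direction. Independence is that of the two factors of a product
  measure.\<close>

lemma
  fixes M :: "'a measure" and F :: "real measure" and N :: "'a \<Rightarrow> nat"
  defines "P \<equiv> M \<Otimes>\<^sub>M PiM (UNIV :: nat set) (\<lambda>_. F)"
  assumes M: "prob_space M" and N: "N \<in> measurable M (count_space UNIV)" and F: "real_distribution F"
  shows prob_space_iid_extension: "prob_space P"
    and distr_fst_iid_extension: "distr P M fst = M"
    and distr_coordinate_iid_extension: "distr P borel (\<lambda>\<omega>. snd \<omega> i) = F"
    and iid_indep_of_iid_extension: "iid_indep_of P (N \<circ> fst) (\<lambda>i \<omega>. snd \<omega> i)"
proof -
  let ?Q = "PiM (UNIV :: nat set) (\<lambda>_. F)"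
  interpret M: prob_space M by fact
  interpret F: real_distribution F by fact
  interpret Q: prob_space ?Q by (intro prob_space_PiM) unfold_locales
  interpret MQ: pair_prob_space M ?Q ..
  show P: "prob_space P"
    unfolding P_def by (rule MQ.prob_space_axioms)
  interpret P: prob_space P by fact
  have [measurable_cong]: "sets F = sets borel"
    by simp
  have [measurable_cong]: "sets P = sets (M \<Otimes>\<^sub>M ?Q)"
    by (simp add: P_def)
  have spP: "space P = space M \<times> space ?Q"
    by (simp add: P_def space_pair_measure)
  show "distr P M fst = M"
    unfolding P_def by (rule Q.distr_pair_fst)
  have snd: "distr P ?Q snd = ?Q"
  proof (rule measure_eqI)
    fix A assume "A \<in> sets (distr P ?Q snd)"
    then have A: "A \<in> sets ?Q" by simp
    then have "snd -` A \<inter> space P = space M \<times> A"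
      using sets.sets_into_space[OF A] by (auto simp: spP)
    then show "emeasure (distr P ?Q snd) A = emeasure ?Q A"
      using A by (simp add: emeasure_distr P_def Q.emeasure_pair_measure_Times M.emeasure_space_1)
  qed simp
  have comp: "distr P borel (\<lambda>\<omega>. snd \<omega> i) = F" for i
  proof -
    have "distr P borel (\<lambda>\<omega>. snd \<omega> i) = distr (distr P ?Q snd) borel (\<lambda>x. x i)"
      by (subst distr_distr) (auto simp: comp_def)
    also have "\<dots> = distr ?Q F (\<lambda>x. x i)"
      unfolding snd by (rule distr_cong) auto
    also have "\<dots> = F"
      by (rule distr_PiM_component) (auto intro: F.prob_space_axioms)
    finally show ?thesis .
  qed
  show "distr P borel (\<lambda>\<omega>. snd \<omega> i) = F"
    by (rule comp)
  have indep: "P.indep_vars (\<lambda>_. borel) (\<lambda>i \<omega>. snd \<omega> i) {1..}"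
  proof (subst P.indep_vars_iff_distr_eq_PiM')
    have "distr P (PiM {1..} (\<lambda>_. borel)) (\<lambda>x. \<lambda>i\<in>{1..}. snd x i) =
      distr (distr P ?Q snd) (PiM {1..} (\<lambda>_. F)) (\<lambda>x. \<lambda>i\<in>{1..}. x i)"
      by (subst distr_distr) (auto simp: comp_def intro!: distr_cong sets_PiM_cong measurable_restrict)
    also have "\<dots> = PiM {1..} (\<lambda>_. F)"
      unfolding snd by (rule distr_PiM_reindex) (auto intro: F.prob_space_axioms)
    finally show "distr P (PiM {1..} (\<lambda>_. borel)) (\<lambda>x. \<lambda>i\<in>{1..}. snd x i) =
      (\<Pi>\<^sub>M i\<in>{1..}. distr P borel (\<lambda>\<omega>. snd \<omega> i))"
      by (simp add: comp)
  qed auto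
  have "P.indep_set {(N \<circ> fst) -` A \<inter> space P | A. A \<in> sets (count_space UNIV)}
    {(\<lambda>\<omega>. \<lambda>i\<in>{1..}. snd \<omega> i) -` B \<inter> space P | B. B \<in> sets (PiM {1..} (\<lambda>_. borel))}"
  proof (rule P.indep_setI)
    have "N \<circ> fst \<in> measurable P (count_space UNIV)"
      using N by measurable
    then show "{(N \<circ> fst) -` A \<inter> space P | A. A \<in> sets (count_space UNIV)} \<subseteq> P.events"
      by (auto intro: measurable_sets)
    have "(\<lambda>\<omega>. \<lambda>i\<in>{1..}. snd \<omega> i) \<in> measurable P (PiM {1..} (\<lambda>_. borel))"
      by measurable
    then show "{(\<lambda>\<omega>. \<lambda>i\<in>{1..}. snd \<omega> i) -` B \<inter> space P | B. B \<in> sets (PiM {1..} (\<lambda>_. borel))} \<subseteq> P.events"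
      by (auto intro: measurable_sets)
    fix a b
    assume "a \<in> {(N \<circ> fst) -` A \<inter> space P | A. A \<in> sets (count_space UNIV)}"
      and "b \<in> {(\<lambda>\<omega>. \<lambda>i\<in>{1..}. snd \<omega> i) -` B \<inter> space P | B. B \<in> sets (PiM {1..} (\<lambda>_. borel))}"
    then obtain A B where a: "a = (N \<circ> fst) -` A \<inter> space P"
      and b: "b = (\<lambda>\<omega>. \<lambda>i\<in>{1..}. snd \<omega> i) -` B \<inter> space P" and B: "B \<in> sets (PiM {1..} (\<lambda>_. borel))"
      by auto
    let ?A = "N -` A \<inter> space M" and ?B = "(\<lambda>x. \<lambda>i\<in>{1..}. x i) -` B \<inter> space ?Q"
    have A': "?A \<in> sets M"
      using N by (rule measurable_sets) simp
    have "(\<lambda>x. \<lambda>i\<in>{1..}. x i) \<in> measurable ?Q (PiM {1..} (\<lambda>_. borel))"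
      by measurable
    then have B': "?B \<in> sets ?Q"
      using B by (rule measurable_sets)
    \<comment> \<open>The two events are cylinders over different factors, so they meet in a
      rectangle, whose measure is a product.\<close>
    have "a = ?A \<times> space ?Q" "b = space M \<times> ?B" "a \<inter> b = ?A \<times> ?B"
      unfolding a b by (auto simp: spP)
    then show "P.prob (a \<inter> b) = P.prob a * P.prob b"
      using A' B' by (simp add: P_def measure_def Q.emeasure_pair_measure_Times enn2real_mult
          M.emeasure_space_1 Q.emeasure_space_1)
  qed
  then show "iid_indep_of P (N \<circ> fst) (\<lambda>i \<omega>. snd \<omega> i)"
    unfolding iid_indep_of_def using indep comp by auto
qed

section \<open>Laplace transforms and power series\<close>

text \<open>On the convex left half plane the derivative of \<open>exp\<close> has modulus at most
  1. This is the source of most error estimates below.\<close>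

lemma norm_exp_diff_le:
  fixes x y :: complex
  assumes "Re x \<le> 0" "Re y \<le> 0"
  shows "norm (exp x - exp y) \<le> norm (x - y)"
proof -
  have "norm (exp x - exp y) \<le> 1 * norm (x - y)"
    by (rule field_differentiable_bound[of "{z. Re z \<le> 0}" exp exp])
       (use assms in \<open>auto intro: DERIV_subset[OF DERIV_exp] convex_halfspace_Re_le\<close>)
  then show ?thesis by simp
qed

context
  fixes \<mu> :: "real measure"
  assumes \<mu>: "real_distribution \<mu>" and nonneg: "AE u in \<mu>. 0 \<le> u"
begin

interpretation real_distribution \<mu> by (rule \<mu>)

lemma integrable_laplace:
  assumes "0 \<le> Re s"
  shows "integrable \<mu> (\<lambda>u. exp (- (s * complex_of_real u)))"
proof (rule integrable_const_bound[where B = 1])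
  show "AE u in \<mu>. norm (exp (- (s * complex_of_real u))) \<le> 1"
    using nonneg by eventually_elim (use assms in simp)
qed simp

lemma norm_laplace_le_1:
  assumes "0 \<le> Re s"
  shows "norm (laplace \<mu> s) \<le> 1"
proof -
  have "norm (laplace \<mu> s) \<le> (\<integral>u. norm (exp (- (s * complex_of_real u))) \<partial>\<mu>)"
    unfolding laplace_def by (rule integral_norm_bound)
  also have "\<dots> \<le> (\<integral>u. 1 \<partial>\<mu>)"
  proof (rule integral_mono_AE)
    show "AE u in \<mu>. norm (exp (- (s * complex_of_real u))) \<le> 1"
      using nonneg by eventually_elim (use assms in simp)
  qed (use integrable_norm[OF integrable_laplace[OF assms]] in auto)
  finally show ?thesis
    using prob_space by simp
qed

text \<open>No moment of \<open>\<mu>\<close> is available, so the pointwise bound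
  \<open>dist (x n) (y n) * u\<close> is used only for convergence of the integrands, while the
  constant 2 dominates them.\<close>

lemma uniformly_continuous_on_laplace: "uniformly_continuous_on {s. 0 \<le> Re s} (laplace \<mu>)"
  unfolding uniformly_continuous_on_sequentially
proof safe
  fix x y :: "nat \<Rightarrow> complex"
  assume x: "\<forall>n. x n \<in> {s. 0 \<le> Re s}" and y: "\<forall>n. y n \<in> {s. 0 \<le> Re s}"
    and lim: "(\<lambda>n. dist (x n) (y n)) \<longlonglongrightarrow> 0"
  let ?d = "\<lambda>n u. exp (- (x n * complex_of_real u)) - exp (- (y n * complex_of_real u))"
  have bound: "norm (exp (- (x n * complex_of_real u))) \<le> 1" "norm (exp (- (y n * complex_of_real u))) \<le> 1"
    if "0 \<le> u" for n u
    using x y that by auto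
  have "(\<lambda>n. \<integral>u. ?d n u \<partial>\<mu>) \<longlonglongrightarrow> (\<integral>u. 0 \<partial>\<mu>)"
  proof (rule integral_dominated_convergence[where w = "\<lambda>_. 2"])
    show "AE u in \<mu>. (\<lambda>n. ?d n u) \<longlonglongrightarrow> 0"
      using nonneg
    proof eventually_elim
      fix u :: real assume u: "0 \<le> u"
      have "norm (?d n u) \<le> dist (x n) (y n) * u" for n
      proof -
        have "norm (?d n u) \<le> norm (- (x n * complex_of_real u) - - (y n * complex_of_real u))"
          using x y u by (intro norm_exp_diff_le) auto
        also have "\<dots> = norm ((x n - y n) * complex_of_real u)"
          by (subst norm_minus_cancel[symmetric]) (simp add: algebra_simps)
        also have "\<dots> = dist (x n) (y n) * u"
          using u by (simp add: dist_norm norm_mult)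
        finally show ?thesis .
      qed
      then show "(\<lambda>n. ?d n u) \<longlonglongrightarrow> 0"
        by (intro Lim_null_comparison[OF _ tendsto_mult_left_zero[OF lim]] always_eventually) auto
    qed
    show "AE u in \<mu>. norm (?d n u) \<le> 2" for n
      using nonneg
    proof eventually_elim
      fix u :: real assume "0 \<le> u"
      from bound[OF this, of n] show "norm (?d n u) \<le> 2"
        using norm_triangle_ineq4[of "exp (- (x n * complex_of_real u))" "exp (- (y n * complex_of_real u))"]
        by linarith
    qed
  qed auto
  moreover have "(\<integral>u. ?d n u \<partial>\<mu>) = laplace \<mu> (x n) - laplace \<mu> (y n)" for n
    unfolding laplace_def using x y
    by (intro Bochner_Integration.integral_diff integrable_laplace) auto
  ultimately have "(\<lambda>n. laplace \<mu> (x n) - laplace \<mu> (y n)) \<longlonglongrightarrow> 0"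
    by simp
  then show "(\<lambda>n. dist (laplace \<mu> (x n)) (laplace \<mu> (y n))) \<longlonglongrightarrow> 0"
    unfolding dist_norm by (rule tendsto_norm_zero)
qed

lemma continuous_on_laplace: "continuous_on {s. 0 \<le> Re s} (laplace \<mu>)"
  by (rule uniformly_continuous_imp_continuous[OF uniformly_continuous_on_laplace])

text \<open>Uniform continuity lets nearby arguments be exchanged even when they do not stay
  bounded.\<close>

lemma tendsto_laplace_diff:
  assumes lim: "((\<lambda>x. f x - g x) \<longlongrightarrow> 0) A"
    and f: "\<forall>\<^sub>F x in A. 0 \<le> Re (f x)" and g: "\<forall>\<^sub>F x in A. 0 \<le> Re (g x)"
  shows "((\<lambda>x. laplace \<mu> (f x) - laplace \<mu> (g x)) \<longlongrightarrow> 0) A"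
proof (rule tendstoI)
  fix e :: real assume "0 < e"
  then obtain d where "0 < d" and d: "\<And>s s'. 0 \<le> Re s \<Longrightarrow> 0 \<le> Re s' \<Longrightarrow> dist s' s < d \<Longrightarrow>
      dist (laplace \<mu> s') (laplace \<mu> s) < e"
    using uniformly_continuous_on_laplace unfolding uniformly_continuous_on_def by force
  have "\<forall>\<^sub>F x in A. dist (f x - g x) 0 < d"
    using lim \<open>0 < d\<close> by (rule tendstoD)
  then show "\<forall>\<^sub>F x in A. dist (laplace \<mu> (f x) - laplace \<mu> (g x)) 0 < e"
    using f g
  proof eventually_elim
    fix x assume "dist (f x - g x) 0 < d" "0 \<le> Re (f x)" "0 \<le> Re (g x)"
    then show "dist (laplace \<mu> (f x) - laplace \<mu> (g x)) 0 < e"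
      using d[of "g x" "f x"] by (simp add: dist_norm)
  qed
qed

text \<open>The coefficients are Poisson probabilities with mean \<open>a * u\<close>, averaged over
  \<open>\<mu>\<close>. Poisson weights have total mass 1, so the constant 1 dominates all partial
  sums on the closed disc, boundary included.\<close>

lemma laplace_powser:
  assumes a: "0 \<le> a" and z: "norm z \<le> 1"
  shows "(\<lambda>k. complex_of_real (\<integral>u. exp (- (a * u)) * (a * u) ^ k / fact k \<partial>\<mu>) * z ^ k)
    sums laplace \<mu> (complex_of_real a * (1 - z))"
proof -
  let ?w = "\<lambda>k u. exp (- (a * u)) * (a * u) ^ k / fact k"
  let ?s = "\<lambda>n u. \<Sum>k<n. complex_of_real (?w k u) * z ^ k"
  have w_le: "(\<Sum>k<n. ?w k u) \<le> 1" if "0 \<le> u" for n u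
  proof -
    have "(\<lambda>k. (a * u) ^ k /\<^sub>R fact k) sums exp (a * u)"
      by (rule exp_converges)
    then have "(\<Sum>k<n. (a * u) ^ k /\<^sub>R fact k) \<le> exp (a * u)"
      using a that by (intro sums_le[OF _ sums_If_finite_set[of "{..<n}"], of "\<lambda>k. (a * u) ^ k /\<^sub>R fact k"]) auto
    then have "exp (- (a * u)) * (\<Sum>k<n. (a * u) ^ k /\<^sub>R fact k) \<le> exp (- (a * u)) * exp (a * u)"
      by (intro mult_left_mono) auto
    then show ?thesis
      by (simp add: sum_distrib_left exp_minus field_simps)
  qed
  have w_nonneg: "0 \<le> ?w k u" if "0 \<le> u" for k u
    using a that by simp
  have int: "integrable \<mu> (?w k)" for k
  proof (rule integrable_const_bound[where B = 1])
    show "AE u in \<mu>. norm (?w k u) \<le> 1"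
      using nonneg
    proof eventually_elim
      fix u :: real assume u: "0 \<le> u"
      have "?w k u \<le> (\<Sum>i<Suc k. ?w i u)"
        using w_nonneg[OF u] by (intro member_le_sum) auto
      also have "\<dots> \<le> 1"
        by (rule w_le[OF u])
      finally show "norm (?w k u) \<le> 1"
        using w_nonneg[OF u, of k] by (simp only: real_norm_def abs_of_nonneg)
    qed
  qed simp
  have "(\<lambda>n. \<integral>u. ?s n u \<partial>\<mu>) \<longlonglongrightarrow> (\<integral>u. exp (- (complex_of_real a * (1 - z) * complex_of_real u)) \<partial>\<mu>)"
  proof (rule integral_dominated_convergence[where w = "\<lambda>_. 1"])
    show "AE u in \<mu>. (\<lambda>n. ?s n u) \<longlonglongrightarrow> exp (- (complex_of_real a * (1 - z) * complex_of_real u))"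
    proof (rule AE_I2)
      fix u
      let ?v = "complex_of_real (a * u)"
      have "(\<lambda>k. exp (- ?v) * ((?v * z) ^ k /\<^sub>R fact k)) sums (exp (- ?v) * exp (?v * z))"
        by (intro sums_mult exp_converges)
      moreover have "exp (- ?v) * exp (?v * z) = exp (- (complex_of_real a * (1 - z) * complex_of_real u))"
        by (simp add: exp_add[symmetric] algebra_simps)
      moreover have "exp (- ?v) * ((?v * z) ^ k /\<^sub>R fact k) = complex_of_real (?w k u) * z ^ k" for k
        by (simp add: exp_of_real[symmetric] power_mult_distrib scaleR_conv_of_real field_simps)
      ultimately show "(\<lambda>n. ?s n u) \<longlonglongrightarrow> exp (- (complex_of_real a * (1 - z) * complex_of_real u))"
        by (simp add: sums_def)
    qed
    show "AE u in \<mu>. norm (?s n u) \<le> 1" for n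
      using nonneg
    proof eventually_elim
      fix u :: real assume u: "0 \<le> u"
      have "norm (?s n u) \<le> (\<Sum>k<n. ?w k u)"
      proof (rule sum_norm_le)
        fix k
        show "norm (complex_of_real (?w k u) * z ^ k) \<le> ?w k u"
          using w_nonneg[OF u, of k] z
          by (simp only: norm_mult norm_power norm_of_real abs_of_nonneg mult_left_le power_le_one norm_ge_zero)
      qed
      with w_le[OF u, of n] show "norm (?s n u) \<le> 1"
        by linarith
    qed
  qed auto
  moreover have "(\<integral>u. ?s n u \<partial>\<mu>) = (\<Sum>k<n. complex_of_real (\<integral>u. ?w k u \<partial>\<mu>) * z ^ k)" for n
  proof -
    have "(\<integral>u. ?s n u \<partial>\<mu>) = (\<Sum>k<n. \<integral>u. complex_of_real (?w k u) * z ^ k \<partial>\<mu>)"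
      by (intro Bochner_Integration.integral_sum integrable_mult_left integrable_of_real int)
    then show ?thesis
      by (simp only: integral_mult_left_zero integral_complex_of_real)
  qed
  ultimately show ?thesis
    by (simp add: sums_def laplace_def)
qed

end

section \<open>Comparing generating functions by coefficients\<close>

lemma powser_eq_0_imp_coeff_eq_0:
  fixes a :: "nat \<Rightarrow> real"
  assumes "0 < r" and zero: "\<And>x. 0 < x \<Longrightarrow> x < r \<Longrightarrow> (\<lambda>n. a n * x ^ n) sums 0"
  shows "a n = 0"
proof (rule ccontr)
  assume an: "a n \<noteq> 0"
  \<comment> \<open>Multiplication by \<open>x\<close> makes the function vanish at 0 and moves the
    nonzero coefficient to the positive index \<open>Suc n\<close>, which is the setting of
    \<open>powser_0_nonzero\<close>: such a zero is isolated.\<close>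
  define b where "b k = (case k of 0 \<Rightarrow> 0 | Suc l \<Rightarrow> a l)" for k
  define f where "f x = x * (\<Sum>k. a k * x ^ k)" for x
  have sums: "(\<lambda>k. b k * x ^ k) sums f x" if "norm (x - 0) < r / 2" for x
  proof -
    have "summable (\<lambda>k. a k * x ^ k)"
      by (rule powser_inside[of a "r / 2"]) (use zero[of "r / 2"] that \<open>0 < r\<close> in \<open>auto simp: sums_iff\<close>)
    then have "(\<lambda>k. x * (a k * x ^ k)) sums f x"
      unfolding f_def by (intro sums_mult summable_sums)
    then have "(\<lambda>k. b (Suc k) * x ^ Suc k) sums f x"
      by (simp add: b_def mult_ac)
    then show ?thesis
      by (subst (asm) sums_Suc_iff) (simp add: b_def)
  qed
  obtain s where "0 < s" and s: "\<And>z. z \<in> cball 0 s - {0} \<Longrightarrow> f z \<noteq> 0"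
    by (rule powser_0_nonzero[of "r / 2" 0 b f "Suc n"])
       (use sums an \<open>0 < r\<close> in \<open>auto simp: f_def b_def\<close>)
  define x where "x = min s (r / 2)"
  have x: "0 < x" "x < r" "x \<le> s"
    using \<open>0 < s\<close> \<open>0 < r\<close> by (auto simp: x_def min_def)
  have "f x = 0"
    unfolding f_def using sums_unique[OF zero[OF x(1,2)]] by simp
  with s[of x] x show False
    by auto
qed

lemma (in prob_space) pgf_powser:
  assumes N[measurable]: "N \<in> measurable M (count_space UNIV)" and z: "norm (z :: complex) \<le> 1"
  shows "(\<lambda>n. complex_of_real (prob (N -` {n} \<inter> space M)) * z ^ n) sums (\<integral>\<omega>. z ^ N \<omega> \<partial>M)"
proof -
  have "(\<lambda>n. \<integral>\<omega>. indicator {n} (N \<omega>) * z ^ n \<partial>M) sums (\<integral>\<omega>. z ^ N \<omega> \<partial>M)"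
    using z by (intro sums_integral_nat_valued[OF N, where B = 1]) (auto simp: norm_power power_le_one)
  moreover have "(\<integral>\<omega>. indicator {n} (N \<omega>) * z ^ n \<partial>M) = complex_of_real (prob (N -` {n} \<inter> space M)) * z ^ n" for n
  proof -
    have "(\<integral>\<omega>. indicator {n} (N \<omega>) * z ^ n \<partial>M) = (\<integral>\<omega>. complex_of_real (indicator (N -` {n}) \<omega>) * z ^ n \<partial>M)"
      by (intro Bochner_Integration.integral_cong) (simp_all add: indicator_def)
    also have "\<dots> = complex_of_real (\<integral>\<omega>. indicator (N -` {n}) \<omega> \<partial>M) * z ^ n"
      by (simp only: integral_mult_left_zero integral_complex_of_real)
    also have "(\<integral>\<omega>. indicator (N -` {n}) \<omega> \<partial>M) = prob (N -` {n} \<inter> space M)"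
      by (rule Bochner_Integration.integral_indicator)
    finally show ?thesis .
  qed
  ultimately show ?thesis by (simp only:)
qed

text \<open>Both sides are power series converging on the closed unit disc. They agree for real
  arguments in (0,1), hence coefficient by coefficient, hence at every \<open>z\<close> with
  \<open>norm z \<le> 1\<close>.\<close>

lemma pgf_complex_extension:
  fixes \<mu> :: "real measure"
  assumes \<mu>: "real_distribution \<mu>" and nonneg: "AE u in \<mu>. 0 \<le> u"
    and M: "prob_space M" and N: "N \<in> measurable M (count_space UNIV)"
    and m: "1 \<le> m" and \<theta>: "0 < \<theta>"
    and pgf: "\<And>s. 0 < s \<Longrightarrow> s < 1 \<Longrightarrow> complex_of_real (pgf M N s) =
      complex_of_real s ^ j * laplace \<mu> (complex_of_real ((1 - s ^ m) / \<theta>))"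
    and z: "norm z \<le> 1"
  shows "(\<integral>\<omega>. z ^ N \<omega> \<partial>M) = z ^ j * laplace \<mu> ((1 - z ^ m) / complex_of_real \<theta>)"
proof -
  interpret prob_space M by fact
  define d where "d k = (\<integral>u. exp (- (1 / \<theta> * u)) * (1 / \<theta> * u) ^ k / fact k \<partial>\<mu>)" for k :: nat
  define c where "c n = prob (N -` {n} \<inter> space M)" for n
  \<comment> \<open>Substituting \<open>z ^ m\<close> and multiplying by \<open>z ^ j\<close> puts
    the coefficient \<open>d k\<close> at index \<open>j + m * k\<close>; all other coefficients
    vanish.\<close>
  define e where "e n = (if j \<le> n \<and> m dvd (n - j) then d ((n - j) div m) else 0)" for n
  have c: "(\<lambda>n. complex_of_real (c n) * z ^ n) sums (\<integral>\<omega>. z ^ N \<omega> \<partial>M)" if "norm z \<le> 1" for z :: complex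
    unfolding c_def by (rule pgf_powser[OF N that])
  have e: "(\<lambda>n. complex_of_real (e n) * z ^ n) sums (z ^ j * laplace \<mu> ((1 - z ^ m) / complex_of_real \<theta>))"
    if z: "norm z \<le> 1" for z :: complex
  proof -
    define g where "g k = j + m * k" for k
    have "strict_mono g"
      using m by (auto simp: strict_mono_def g_def)
    moreover have "n \<in> range g" if "e n \<noteq> 0" for n
    proof -
      have "j \<le> n" "m dvd n - j"
        using that by (auto simp: e_def split: if_splits)
      then have "n = g ((n - j) div m)"
        by (simp add: g_def)
      then show ?thesis by blast
    qed
    moreover have "(\<lambda>k. complex_of_real (e (g k)) * z ^ g k) sums
      (z ^ j * laplace \<mu> ((1 - z ^ m) / complex_of_real \<theta>))"
    proof -
      have "norm (z ^ m) \<le> 1"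
        using z by (simp add: norm_power power_le_one)
      then have "(\<lambda>k. complex_of_real (d k) * (z ^ m) ^ k) sums laplace \<mu> (complex_of_real (1 / \<theta>) * (1 - z ^ m))"
        unfolding d_def using \<theta> by (intro laplace_powser[OF \<mu> nonneg]) auto
      from sums_mult[OF this, of "z ^ j"] show ?thesis
        using m by (simp add: g_def e_def power_add power_mult[symmetric] mult_ac)
    qed
    ultimately show ?thesis
      by (subst (asm) sums_mono_reindex[where f = "\<lambda>n. complex_of_real (e n) * z ^ n"]) auto
  qed
  have "c n - e n = 0" for n
  proof (rule powser_eq_0_imp_coeff_eq_0[of 1])
    fix s :: real assume s: "0 < s" "s < 1"
    have "(\<integral>\<omega>. complex_of_real s ^ N \<omega> \<partial>M) = complex_of_real (pgf M N s)"
      unfolding pgf_def by (simp flip: of_real_power)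
    also have "\<dots> = complex_of_real s ^ j * laplace \<mu> ((1 - complex_of_real s ^ m) / complex_of_real \<theta>)"
      unfolding pgf[OF s] by simp
    finally have "(\<lambda>n. complex_of_real (c n) * complex_of_real s ^ n - complex_of_real (e n) * complex_of_real s ^ n) sums 0"
      using sums_diff[OF c[of "complex_of_real s"] e[of "complex_of_real s"]] s by simp
    then have "(\<lambda>n. complex_of_real ((c n - e n) * s ^ n)) sums complex_of_real 0"
      by (simp add: algebra_simps)
    then show "(\<lambda>n. (c n - e n) * s ^ n) sums 0"
      by (simp only: sums_of_real_iff)
  qed simp
  then have "c = e" by auto
  with c[OF z] e[OF z] show ?thesis
    by (auto intro: sums_unique2)
qed

section \<open>Compound Poisson laws\<close>

text \<open>The law is that of a sum of i.i.d. variables with law \<open>F\<close>, whose number of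
  terms is Poisson with random mean \<open>a * u\<close>, \<open>u\<close> drawn from
  \<open>\<mu>\<close>.\<close>

lemma ex_mixed_compound_Poisson:
  assumes \<mu>: "real_distribution \<mu>" and nonneg: "AE u in \<mu>. 0 \<le> u"
    and F: "real_distribution F" and a: "0 \<le> a"
  shows "\<exists>G. real_distribution G \<and> (\<forall>t. char G t = laplace \<mu> (complex_of_real a * (1 - char F t)))"
proof -
  interpret \<mu>: real_distribution \<mu> by fact
  define d where "d k = (\<integral>u. exp (- (a * u)) * (a * u) ^ k / fact k \<partial>\<mu>)" for k :: nat
  define p where "p = embed_pmf d"
  have d: "(\<lambda>k. complex_of_real (d k) * z ^ k) sums laplace \<mu> (complex_of_real a * (1 - z))" if "norm z \<le> 1" for z
    unfolding d_def by (rule laplace_powser[OF \<mu> nonneg a that])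
  have d_nonneg: "0 \<le> d k" for k
    unfolding d_def using nonneg by (intro integral_nonneg_AE, eventually_elim) (use a in auto)
  \<comment> \<open>At \<open>z = 1\<close> the generating function is the Laplace transform at 0,
    so the weights \<open>d\<close> form a probability mass function.\<close>
  have "(\<lambda>k. complex_of_real (d k)) sums complex_of_real 1"
    using d[of 1] \<mu>.prob_space by (simp add: laplace_def)
  then have "d sums 1"
    by (simp only: sums_of_real_iff)
  then have "(\<integral>\<^sup>+ k. ennreal (d k) \<partial>count_space UNIV) = 1"
    using d_nonneg by (subst nn_integral_count_space_nat) (auto simp: suminf_ennreal_eq sums_unique[symmetric])
  then have p: "pmf p k = d k" for k
    unfolding p_def using d_nonneg by (intro pmf_embed_pmf) auto
  let ?Q = "measure_pmf p \<Otimes>\<^sub>M PiM (UNIV :: nat set) (\<lambda>_. F)"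
  let ?N = "id :: nat \<Rightarrow> nat"
  let ?S = "\<lambda>\<omega> :: nat \<times> (nat \<Rightarrow> real). \<Sum>i = 1..(?N \<circ> fst) \<omega>. snd \<omega> i"
  have N: "?N \<in> measurable (measure_pmf p) (count_space UNIV)"
    by simp
  have Q: "prob_space ?Q"
    by (rule prob_space_iid_extension[OF prob_space_measure_pmf N F])
  have iid: "iid_indep_of ?Q (?N \<circ> fst) (\<lambda>i \<omega>. snd \<omega> i)"
    by (rule iid_indep_of_iid_extension[OF prob_space_measure_pmf N F])
  have N': "?N \<circ> fst \<in> measurable ?Q (count_space UNIV)"
    by (simp add: comp_def)
  have "real_distribution (distr ?Q borel ?S)"
    using iid_indep_of_measurable_random_sum[OF Q iid N'] by (rule prob_space.real_distribution_distr[OF Q])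
  moreover have "char (distr ?Q borel ?S) t = laplace \<mu> (complex_of_real a * (1 - char F t))" for t
  proof -
    have z: "norm (char F t) \<le> 1"
      by (rule real_distribution.cmod_char_le_1[OF F])
    have "char (distr ?Q borel ?S) t = (\<integral>\<omega>. char F t ^ (?N \<circ> fst) \<omega> \<partial>?Q)"
      using char_random_sum[OF Q iid N', of t]
      unfolding distr_coordinate_iid_extension[OF prob_space_measure_pmf N F] .
    also have "\<dots> = (\<integral>n. char F t ^ n \<partial>distr ?Q (measure_pmf p) fst)"
      by (subst integral_distr) auto
    also have "\<dots> = (\<integral>n. char F t ^ n \<partial>measure_pmf p)"
      unfolding distr_fst_iid_extension[OF prob_space_measure_pmf N F] ..
    also have "\<dots> = laplace \<mu> (complex_of_real a * (1 - char F t))"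
      using prob_space.pgf_powser[OF prob_space_measure_pmf N z] d[OF z]
      by (intro sums_unique2) (auto simp: p[symmetric] measure_pmf_single)
    finally show ?thesis .
  qed
  ultimately show ?thesis by blast
qed

text \<open>The mixing law is the point mass at 1, whose Laplace transform is
  \<open>exp (- s)\<close>.\<close>

lemma ex_compound_Poisson:
  assumes F: "real_distribution F" and a: "0 \<le> a"
  shows "\<exists>G. real_distribution G \<and> (\<forall>t. char G t = exp (- (complex_of_real a * (1 - char F t))))"
proof -
  have "real_distribution (return borel (1 :: real))"
    by (simp add: real_distribution_def real_distribution_axioms_def prob_space_return)
  moreover have "AE u in return borel (1 :: real). 0 \<le> u"
    by (subst AE_return) auto
  moreover have "laplace (return borel 1) s = exp (- s)" for s
    unfolding laplace_def by (subst integral_return) auto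
  ultimately show ?thesis
    using ex_mixed_compound_Poisson[OF _ _ F a] by metis
qed

section \<open>Characteristic functions near the origin\<close>

text \<open>The integrand on the right is bounded, continuous and free of \<open>t\<close>, so weak
  convergence can be applied to it once for all \<open>t\<close> with
  \<open>\<bar>t\<bar> \<le> d\<close>.\<close>

lemma (in real_distribution) norm_1_minus_char_le:
  assumes "\<bar>t\<bar> \<le> d"
  shows "norm (1 - char M t) \<le> (\<integral>x. min 2 (d * \<bar>x\<bar>) \<partial>M)"
proof -
  have int: "integrable M (\<lambda>x. iexp (t * x))"
    by (rule integrable_iexp) auto
  have "1 - char M t = (\<integral>x. 1 - iexp (t * x) \<partial>M)"
    unfolding char_def using prob_space by (subst Bochner_Integration.integral_diff[OF _ int]) auto
  also have "norm \<dots> \<le> (\<integral>x. norm (1 - iexp (t * x)) \<partial>M)"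
    by (rule integral_norm_bound)
  also have "\<dots> \<le> (\<integral>x. min 2 (d * \<bar>x\<bar>) \<partial>M)"
  proof (rule integral_mono)
    show "integrable M (\<lambda>x. norm (1 - iexp (t * x)))"
      using int by auto
    show "integrable M (\<lambda>x. min 2 (d * \<bar>x\<bar>))"
      using assms by (intro integrable_const_bound[where B = 2]) (auto simp: min_def)
    fix x
    have "norm (1 - iexp (t * x)) \<le> norm (1 :: complex) + norm (iexp (t * x))"
      by (rule norm_triangle_ineq4)
    moreover have "norm (1 - iexp (t * x)) \<le> \<bar>t * x\<bar>"
      using iexp_approx1[of "t * x" 0] by (simp add: norm_minus_commute)
    moreover have "\<bar>t * x\<bar> \<le> d * \<bar>x\<bar>"
      using assms by (simp add: abs_mult mult_right_mono)
    ultimately show "norm (1 - iexp (t * x)) \<le> min 2 (d * \<bar>x\<bar>)"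
      by simp
  qed
  finally show ?thesis .
qed

text \<open>Equicontinuity at 0: \<open>d\<close> is chosen to make the bound of
  \<open>norm_1_minus_char_le\<close> small for the limit \<open>K\<close>, and weak convergence
  carries this over to \<open>G n\<close> for large \<open>n\<close>.\<close>

lemma weak_conv_m_char_near_1:
  assumes G: "\<And>n. real_distribution (G n)" and K: "real_distribution K"
    and conv: "weak_conv_m G K" and "0 < e"
  obtains d where "0 < d" "\<forall>\<^sub>F n in sequentially. \<forall>t. \<bar>t\<bar> \<le> d \<longrightarrow> norm (1 - char (G n) t) < e"
proof -
  interpret K: real_distribution K by fact
  have "(\<lambda>k. \<integral>x. min 2 (inverse (real (Suc k)) * \<bar>x\<bar>) \<partial>K) \<longlonglongrightarrow> (\<integral>x. 0 \<partial>K)"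
  proof (rule integral_dominated_convergence[where w = "\<lambda>_. 2"])
    have "(\<lambda>k. min 2 (inverse (real (Suc k)) * \<bar>x\<bar>)) \<longlonglongrightarrow> min 2 (0 * \<bar>x\<bar>)" for x
      by (intro tendsto_min tendsto_mult tendsto_const LIMSEQ_inverse_real_of_nat)
    then show "AE x in K. (\<lambda>k. min 2 (inverse (real (Suc k)) * \<bar>x\<bar>)) \<longlonglongrightarrow> 0"
      by simp
    show "AE x in K. norm (min 2 (inverse (real (Suc k)) * \<bar>x\<bar>)) \<le> 2" for k
      by (rule AE_I2) (auto simp: min_def)
  qed auto
  then have "\<forall>\<^sub>F k in sequentially. (\<integral>x. min 2 (inverse (real (Suc k)) * \<bar>x\<bar>) \<partial>K) < e"
    using \<open>0 < e\<close> by (intro order_tendstoD(2)) auto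
  then obtain k where k: "(\<integral>x. min 2 (inverse (real (Suc k)) * \<bar>x\<bar>) \<partial>K) < e"
    by (auto simp: eventually_sequentially)
  let ?d = "inverse (real (Suc k))"
  have "(\<lambda>n. \<integral>x. min 2 (?d * \<bar>x\<bar>) \<partial>G n) \<longlonglongrightarrow> (\<integral>x. min 2 (?d * \<bar>x\<bar>) \<partial>K)"
    by (rule weak_conv_imp_integral_bdd_continuous_conv[OF G K conv, where B = 2])
       (intro continuous_intros, simp add: min_def)
  then have "\<forall>\<^sub>F n in sequentially. (\<integral>x. min 2 (?d * \<bar>x\<bar>) \<partial>G n) < e"
    using k by (rule order_tendstoD(2))
  then have "\<forall>\<^sub>F n in sequentially. \<forall>t. \<bar>t\<bar> \<le> ?d \<longrightarrow> norm (1 - char (G n) t) < e"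
    by eventually_elim (blast intro: order.strict_trans1 real_distribution.norm_1_minus_char_le[OF G])
  then show thesis
    by (intro that[of ?d]) auto
qed

lemma (in real_distribution) Re_char: "Re (char M t) = (\<integral>x. cos (t * x) \<partial>M)"
proof -
  have "integrable M (\<lambda>x. iexp (t * x))"
    by (rule integrable_iexp) auto
  then have "Re (char M t) = (\<integral>x. Re (iexp (t * x)) \<partial>M)"
    unfolding char_def by (rule integral_Re[symmetric])
  then show ?thesis by (simp add: Re_exp)
qed

text \<open>Comes from \<open>1 - cos (2 * y) \<le> 4 * (1 - cos y)\<close>, the difference being
  \<open>2 * (1 - cos y)\<^sup>2\<close>. It serves to double an interval on which characteristic
  functions tend to 1.\<close>

lemma (in real_distribution) Re_char_double:
  "1 - Re (char M (2 * t)) \<le> 4 * (1 - Re (char M t))"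
proof -
  have int: "integrable M (\<lambda>x. cos (s * x))" for s
    by (rule integrable_const_bound[where B = 1]) auto
  have "1 - Re (char M (2 * t)) = (\<integral>x. 1 - cos (2 * t * x) \<partial>M)"
    using prob_space by (subst Bochner_Integration.integral_diff[OF _ int]) (auto simp: Re_char)
  also have "\<dots> \<le> (\<integral>x. 4 * (1 - cos (t * x)) \<partial>M)"
  proof (rule integral_mono)
    fix x
    have "0 \<le> (1 - cos (t * x)) ^ 2"
      by simp
    then show "1 - cos (2 * t * x) \<le> 4 * (1 - cos (t * x))"
      using cos_double_cos[of "t * x"] by (simp add: mult.assoc power2_eq_square algebra_simps)
  qed (use int in auto)
  also have "\<dots> = 4 * (1 - Re (char M t))"
    using prob_space
    by (subst integral_mult_right_zero, subst Bochner_Integration.integral_diff[OF _ int]) (auto simp: Re_char)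
  finally show ?thesis .
qed

text \<open>In \<open>(1 + w) ^ n - 1 = w * ?S\<close> every term of the geometric sum is within 3/4
  of 1, so \<open>norm ?S\<close> is at least \<open>n / 4\<close>. Hence a number on the circle of
  radius \<open>1 / (2 * n)\<close> about 1 has its power \<open>n\<close> bounded away from
  1.\<close>

lemma norm_power_minus_1_ge:
  fixes w :: "'a::real_normed_field"
  assumes "real n * norm w = 1 / 2"
  shows "1 / 8 \<le> norm ((1 + w) ^ n - 1)"
proof -
  let ?S = "\<Sum>k<n. (1 + w) ^ k"
  have "norm ((1 + w) ^ k - 1) \<le> 3 / 4" if "k < n" for k
  proof -
    have "norm ((1 + w) ^ k - 1) \<le> (1 + norm w) ^ k - 1"
    proof (induction k)
      case (Suc k)
      have "(1 + w) ^ Suc k - 1 = (1 + w) * ((1 + w) ^ k - 1) + w"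
        by (simp add: algebra_simps)
      also have "norm \<dots> \<le> norm (1 + w) * norm ((1 + w) ^ k - 1) + norm w"
        by (metis norm_mult norm_triangle_ineq)
      also have "\<dots> \<le> (1 + norm w) * ((1 + norm w) ^ k - 1) + norm w"
        using Suc norm_triangle_ineq[of 1 w] by (intro add_right_mono mult_mono) auto
      finally show ?case
        by (simp add: algebra_simps)
    qed simp
    also have "(1 + norm w) ^ k \<le> exp (norm w) ^ k"
      by (intro power_mono exp_ge_add_one_self) auto
    also have "\<dots> = exp (real k * norm w)"
      by (rule exp_of_nat_mult[symmetric])
    also have "\<dots> \<le> exp (1 / 2)"
    proof -
      have "real k * norm w \<le> real n * norm w"
        using that by (intro mult_right_mono) auto
      with assms show ?thesis by simp
    qed
    also have "\<dots> \<le> 1 + 1 / 2 + (1 / 2)\<^sup>2"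
      by (rule exp_bound) auto
    finally show ?thesis
      by (simp add: power2_eq_square)
  qed
  then have "norm (\<Sum>k<n. (1 + w) ^ k - 1) \<le> of_nat (card {..<n}) * (3 / 4)"
    by (intro sum_norm_bound) auto
  then have "norm (?S - of_nat n) \<le> 3 / 4 * real n"
    by (simp add: sum_subtractf)
  moreover have "real n - norm ?S \<le> norm (?S - of_nat n)"
    using norm_triangle_ineq2[of "of_nat n" ?S] by (simp add: norm_minus_commute)
  ultimately have "real n / 4 \<le> norm ?S"
    by linarith
  then have "norm w * (real n / 4) \<le> norm w * norm ?S"
    by (intro mult_left_mono) auto
  also have "\<dots> = norm ((1 + w) ^ n - 1)"
    using power_diff_1_eq[of "1 + w" n] by (simp add: norm_mult)
  finally show ?thesis
    using assms by (simp add: mult_ac)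
qed

text \<open>A continuity argument: the values along the segment from 0 to \<open>t\<close> start at
  1, and by the intermediate value theorem they cannot leave the disc without meeting its boundary.
  It is applied both to roots and to exponents.\<close>

lemma (in real_distribution) norm_char_minus_1_lt_of_circle:
  assumes avoid: "\<And>s. \<bar>s\<bar> \<le> d \<Longrightarrow> norm (1 - char M s) \<noteq> r" and t: "\<bar>t\<bar> \<le> d" and "0 < r"
  shows "norm (1 - char M t) < r"
proof (rule ccontr)
  assume ge: "\<not> norm (1 - char M t) < r"
  have "continuous_on UNIV (char M)"
    by (intro continuous_at_imp_continuous_on ballI isCont_char)
  then have "continuous_on {0..1} (\<lambda>s. char M (s * t))"
    by (rule continuous_on_compose2) (auto intro: continuous_intros)
  then have "continuous_on {0..1} (\<lambda>s. norm (1 - char M (s * t)))"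
    by (intro continuous_on_norm continuous_on_diff continuous_on_const)
  then have "\<exists>s. 0 \<le> s \<and> s \<le> 1 \<and> norm (1 - char M (s * t)) = r"
    using ge \<open>0 < r\<close> by (intro IVT') (simp_all add: char_zero)
  then obtain s where s: "0 \<le> s" "s \<le> 1" "norm (1 - char M (s * t)) = r"
    by blast
  have "\<bar>s * t\<bar> \<le> 1 * d"
    unfolding abs_mult using s t by (intro mult_mono) auto
  with avoid[of "s * t"] s show False by simp
qed

text \<open>Near 0 the powers are within 1/8 of 1, so by \<open>norm_power_minus_1_ge\<close> the
  roots never meet the circle of radius \<open>1 / (2 * k n)\<close> about 1 and stay inside it.
  Doubling then reaches every \<open>t\<close>, for the real parts first.\<close>

lemma char_root_tendsto_1:
  assumes F: "\<And>n. real_distribution (F n)" and G: "\<And>n. real_distribution (G n)"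
    and K: "real_distribution K" and conv: "weak_conv_m G K"
    and k: "filterlim k at_top sequentially"
    and root: "\<And>n t. char (G n) t = char (F n) t ^ k n"
  shows "(\<lambda>n. char (F n) t) \<longlonglongrightarrow> 1"
proof -
  obtain d where "0 < d"
    and d: "\<forall>\<^sub>F n in sequentially. \<forall>t. \<bar>t\<bar> \<le> d \<longrightarrow> norm (1 - char (G n) t) < 1 / 8"
    using weak_conv_m_char_near_1[OF G K conv, of "1 / 8"] by auto
  have k0: "\<forall>\<^sub>F n in sequentially. 0 < k n"
    using eventually_compose_filterlim[OF eventually_gt_at_top k] .
  have near: "(\<lambda>n. 1 - Re (char (F n) t)) \<longlonglongrightarrow> 0" if "\<bar>t\<bar> \<le> d" for t
  proof (rule Lim_null_comparison)
    show "(\<lambda>n. 1 / 2 * inverse (real (k n))) \<longlonglongrightarrow> 0"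
      using filterlim_compose[OF lim_inverse_n k] by (intro tendsto_mult_right_zero) auto
    show "\<forall>\<^sub>F n in sequentially. norm (1 - Re (char (F n) t)) \<le> 1 / 2 * inverse (real (k n))"
      using d k0
    proof eventually_elim
      fix n assume n: "\<forall>t. \<bar>t\<bar> \<le> d \<longrightarrow> norm (1 - char (G n) t) < 1 / 8" and kn: "0 < k n"
      have "norm (1 - char (F n) t) < 1 / 2 * inverse (real (k n))"
      proof (rule real_distribution.norm_char_minus_1_lt_of_circle[OF F _ that])
        fix s assume s: "\<bar>s\<bar> \<le> d"
        show "norm (1 - char (F n) s) \<noteq> 1 / 2 * inverse (real (k n))"
        proof
          assume "norm (1 - char (F n) s) = 1 / 2 * inverse (real (k n))"
          then have "1 / 8 \<le> norm ((1 + (char (F n) s - 1)) ^ k n - 1)"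
            using kn by (intro norm_power_minus_1_ge) (simp add: norm_minus_commute field_simps)
          with n s show False
            by (simp add: root norm_minus_commute) (meson not_less)
        qed
      qed (use kn in simp)
      moreover have "\<bar>1 - Re (char (F n) t)\<bar> \<le> norm (1 - char (F n) t)"
        using abs_Re_le_cmod[of "1 - char (F n) t"] by simp
      ultimately show "norm (1 - Re (char (F n) t)) \<le> 1 / 2 * inverse (real (k n))"
        by simp
    qed
  qed
  have Re_le: "Re (char (F n) t) \<le> 1" for n t
    using complex_Re_le_cmod[of "char (F n) t"] real_distribution.cmod_char_le_1[OF F, of n t] by linarith
  \<comment> \<open>Each doubling costs only a factor 4, which is harmless because the number of
    doublings depends on \<open>t\<close> but not on \<open>n\<close>.\<close>
  have "(\<lambda>n. 1 - Re (char (F n) t)) \<longlonglongrightarrow> 0" if "\<bar>t\<bar> \<le> 2 ^ i * d" for i t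
    using that
  proof (induction i arbitrary: t)
    case (Suc i)
    show ?case
    proof (rule Lim_null_comparison)
      show "(\<lambda>n. 4 * (1 - Re (char (F n) (t / 2)))) \<longlonglongrightarrow> 0"
        using Suc.prems by (intro tendsto_mult_right_zero Suc.IH) auto
      show "\<forall>\<^sub>F n in sequentially. norm (1 - Re (char (F n) t)) \<le> 4 * (1 - Re (char (F n) (t / 2)))"
        using real_distribution.Re_char_double[OF F, of _ "t / 2"] Re_le by (intro always_eventually) auto
    qed
  qed (simp add: near)
  moreover obtain i :: nat where "\<bar>t\<bar> / d < 2 ^ i"
    using real_arch_pow[of 2] by auto
  then have "\<bar>t\<bar> \<le> 2 ^ i * d"
    using \<open>0 < d\<close> by (simp add: field_simps)
  ultimately have Re_lim: "(\<lambda>n. 1 - Re (char (F n) t)) \<longlonglongrightarrow> 0"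
    by blast
  \<comment> \<open>For \<open>norm z \<le> 1\<close> the real part controls everything: the square
    of \<open>norm (z - 1)\<close> is at most \<open>2 * (1 - Re z)\<close>.\<close>
  have "(\<lambda>n. char (F n) t - 1) \<longlonglongrightarrow> 0"
  proof (rule Lim_null_comparison)
    show "(\<lambda>n. sqrt (2 * (1 - Re (char (F n) t)))) \<longlonglongrightarrow> 0"
      using tendsto_real_sqrt[OF tendsto_mult_right_zero[OF Re_lim, of 2]] by (simp only: real_sqrt_zero)
    show "\<forall>\<^sub>F n in sequentially. norm (char (F n) t - 1) \<le> sqrt (2 * (1 - Re (char (F n) t)))"
    proof (intro always_eventually allI real_le_rsqrt)
      fix n
      have "(norm (char (F n) t))\<^sup>2 \<le> 1"
        using real_distribution.cmod_char_le_1[OF F] by (simp add: power_le_one)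
      then show "(norm (char (F n) t - 1))\<^sup>2 \<le> 2 * (1 - Re (char (F n) t))"
        unfolding cmod_power2 by (simp add: power2_eq_square algebra_simps)
    qed
  qed
  then show ?thesis
    by (simp add: LIM_zero_iff)
qed

section \<open>Passing between families indexed by \<theta> and sequences\<close>

lemma tends_in_law_at_0_imp_weak_conv_m:
  assumes "tends_in_law_at_0 M Y L" and "filterlim x (at_right 0) sequentially"
  shows "weak_conv_m (\<lambda>n. distr (M (x n)) borel (Y (x n))) L"
  unfolding weak_conv_m_def weak_conv_def
proof safe
  fix y assume "isCont (cdf L) y"
  then have "((\<lambda>\<theta>. cdf (distr (M \<theta>) borel (Y \<theta>)) y) \<longlongrightarrow> cdf L y) (at_right 0)"
    using assms(1) unfolding tends_in_law_at_0_def by auto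
  then show "(\<lambda>n. cdf (distr (M (x n)) borel (Y (x n))) y) \<longlonglongrightarrow> cdf L y"
    using assms(2) by (rule filterlim_compose)
qed

text \<open>A one-sided limit can be tested along positive sequences tending to 0, and along each of
  them the continuity theorem of Levy applies.\<close>

lemma tends_in_law_at_0I:
  assumes M: "\<And>\<theta>. 0 < \<theta> \<Longrightarrow> prob_space (M \<theta>)"
    and Y: "\<And>\<theta>. 0 < \<theta> \<Longrightarrow> Y \<theta> \<in> borel_measurable (M \<theta>)"
    and L: "real_distribution L"
    and lim: "\<And>t. ((\<lambda>\<theta>. char (distr (M \<theta>) borel (Y \<theta>)) t) \<longlongrightarrow> char L t) (at_right 0)"
  shows "tends_in_law_at_0 M Y L"
  unfolding tends_in_law_at_0_def
proof (intro conjI allI impI L)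
  fix y assume y: "isCont (cdf L) y"
  show "((\<lambda>\<theta>. cdf (distr (M \<theta>) borel (Y \<theta>)) y) \<longlongrightarrow> cdf L y) (at_right 0)"
  proof (rule tendsto_at_right_sequentially[of 0 1])
    fix x :: "nat \<Rightarrow> real"
    assume x: "\<And>n. 0 < x n" "x \<longlonglongrightarrow> 0"
    then have x': "filterlim x (at_right 0) sequentially"
      by (intro tendsto_imp_filterlim_at_right always_eventually) auto
    have "weak_conv_m (\<lambda>n. distr (M (x n)) borel (Y (x n))) L"
    proof (rule levy_continuity[OF _ L])
      show "real_distribution (distr (M (x n)) borel (Y (x n)))" for n
        using M Y x(1) by (intro prob_space.real_distribution_distr) auto
      show "(\<lambda>n. char (distr (M (x n)) borel (Y (x n))) t) \<longlonglongrightarrow> char L t" for t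
        using lim x' by (rule filterlim_compose)
    qed
    then show "(\<lambda>n. cdf (distr (M (x n)) borel (Y (x n))) y) \<longlonglongrightarrow> cdf L y"
      using y unfolding weak_conv_m_def weak_conv_def by auto
  qed simp
qed

section \<open>Tightness from equicontinuity at 0\<close>

lemma Parseval_char:
  assumes G: "real_distribution G" and H: "real_distribution H"
  shows "(\<integral>t. char G (s * t) \<partial>H) = (\<integral>x. char H (s * x) \<partial>G)"
proof -
  interpret G: real_distribution G by fact
  interpret H: real_distribution H by fact
  interpret HG: pair_prob_space H G ..
  have [measurable_cong]: "sets G = sets borel" "sets H = sets borel"
    by simp_all
  have "integrable (H \<Otimes>\<^sub>M G) (\<lambda>(t, x). iexp (s * t * x))"
    by (rule HG.integrable_const_bound[where B = 1]) auto
  then have "(\<integral>x. (\<integral>t. iexp (s * t * x) \<partial>H) \<partial>G) = (\<integral>t. (\<integral>x. iexp (s * t * x) \<partial>G) \<partial>H)"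
    by (rule HG.Fubini_integral)
  then show ?thesis
    by (simp add: char_def mult_ac)
qed

lemma (in real_distribution) small_tail:
  assumes "0 < e"
  obtains R where "0 < R" "measure M {x. R < \<bar>x\<bar>} < e"
proof -
  have "(\<lambda>k. measure M {x. real (Suc k) < \<bar>x\<bar>}) \<longlonglongrightarrow> measure M (\<Inter>k. {x. real (Suc k) < \<bar>x\<bar>})"
    by (rule finite_Lim_measure_decseq) (auto simp: decseq_def)
  moreover have "(\<Inter>k. {x. real (Suc k) < \<bar>x\<bar>}) = {}"
  proof -
    have "\<exists>k. \<not> real (Suc k) < \<bar>x\<bar>" for x
    proof -
      obtain k where "\<bar>x\<bar> \<le> real k"
        using real_arch_simple by blast
      then show ?thesis
        by (intro exI[of _ k]) simp
    qed
    then show ?thesis by blast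
  qed
  ultimately have "\<forall>\<^sub>F k in sequentially. measure M {x. real (Suc k) < \<bar>x\<bar>} < e"
    using assms by (intro order_tendstoD(2)) auto
  then obtain k where "measure M {x. real (Suc k) < \<bar>x\<bar>} < e"
    by (auto simp: eventually_sequentially)
  then show thesis
    by (intro that[of "real (Suc k)"]) auto
qed

text \<open>
  Integrating \<^term>\<open>1 - char M (s * t)\<close> against the standard normal law in \<^term>\<open>t\<close>
  produces \<^term>\<open>1 - exp (- (s * x)\<^sup>2 / 2)\<close>, which is at least \<open>1/2\<close> outside a bounded set.
\<close>
lemma (in real_distribution) tail_le_of_char_near_1:
  assumes tail: "measure std_normal_distribution {t. R < \<bar>t\<bar>} \<le> e" and "0 < R" "0 < d"
    and near: "\<And>t. \<bar>t\<bar> \<le> d \<Longrightarrow> norm (1 - char M t) \<le> e"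
  shows "measure M {x. 2 * R / d \<le> \<bar>x\<bar>} \<le> 6 * e"
proof -
  interpret N: real_distribution std_normal_distribution
    by (rule real_dist_normal_dist)
  \<comment> \<open>With this scale \<open>\<bar>t\<bar> \<le> R\<close> implies
    \<open>\<bar>s * t\<bar> \<le> d\<close>, so only the normal tail escapes \<open>near\<close>
    and is met with the trivial bound 2. The total is \<open>e + 2 * e\<close>, and dividing by the
    lower bound 1/2 gives \<open>6 * e\<close>.\<close>
  define s where "s = d / R"
  have "0 < s" and s: "s * R = d"
    using assms by (auto simp: s_def)
  have le2: "norm (1 - char M t) \<le> 2" for t
    using norm_triangle_ineq4[of 1 "char M t"] cmod_char_le_1[of t] by simp
  have int_char: "integrable std_normal_distribution (\<lambda>t. char M (s * t))"
    using cmod_char_le_1 by (intro N.integrable_const_bound[where B = 1]) auto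
  have int_exp: "integrable M (\<lambda>x. exp (- (s * x)\<^sup>2 / 2))"
    by (rule integrable_const_bound[where B = 1]) auto
  have ind: "integrable std_normal_distribution (indicator {t. R < \<bar>t\<bar>} :: real \<Rightarrow> real)"
    by (intro integrable_real_indicator) (auto simp: N.emeasure_eq_measure)
  have "(1 / 2) * measure M {x. 2 / s \<le> \<bar>x\<bar>} = (\<integral>x. 1 / 2 * indicator {x. 2 / s \<le> \<bar>x\<bar>} x \<partial>M)"
    by simp
  also have "\<dots> \<le> (\<integral>x. 1 - exp (- (s * x)\<^sup>2 / 2) \<partial>M)"
  proof (rule integral_mono)
    show "integrable M (\<lambda>x. 1 / 2 * indicator {x. 2 / s \<le> \<bar>x\<bar>} x :: real)"
      by (intro integrable_mult_right integrable_real_indicator) (auto simp: emeasure_eq_measure)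
    show "integrable M (\<lambda>x. 1 - exp (- (s * x)\<^sup>2 / 2))"
      using int_exp by auto
    fix x
    show "1 / 2 * indicator {x. 2 / s \<le> \<bar>x\<bar>} x \<le> 1 - exp (- (s * x)\<^sup>2 / 2)"
    proof (cases "2 / s \<le> \<bar>x\<bar>")
      case True
      then have "2 \<le> \<bar>s * x\<bar>"
        using \<open>0 < s\<close> by (simp add: abs_mult field_simps)
      then have "2\<^sup>2 \<le> \<bar>s * x\<bar>\<^sup>2"
        by (intro power_mono) auto
      then have "2 \<le> (s * x)\<^sup>2 / 2"
        by simp
      then have "2 \<le> exp ((s * x)\<^sup>2 / 2)"
        using exp_ge_add_one_self[of "(s * x)\<^sup>2 / 2"] by linarith
      then have "inverse (exp ((s * x)\<^sup>2 / 2)) \<le> inverse 2"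
        by (intro le_imp_inverse_le) auto
      then show ?thesis
        using True by (simp add: exp_minus)
    qed simp
  qed
  also have "\<dots> = Re (\<integral>t. 1 - char M (s * t) \<partial>std_normal_distribution)"
  proof -
    have "(\<integral>t. char M (s * t) \<partial>std_normal_distribution) = (\<integral>x. char std_normal_distribution (s * x) \<partial>M)"
      by (rule Parseval_char[OF real_distribution_axioms real_dist_normal_dist])
    also have "\<dots> = complex_of_real (\<integral>x. exp (- (s * x)\<^sup>2 / 2) \<partial>M)"
      unfolding char_std_normal_distribution by (rule integral_complex_of_real)
    finally show ?thesis
      using int_exp int_char prob_space N.prob_space by simp
  qed
  also have "\<dots> \<le> norm (\<integral>t. 1 - char M (s * t) \<partial>std_normal_distribution)"
    by (rule complex_Re_le_cmod)
  also have "\<dots> \<le> (\<integral>t. norm (1 - char M (s * t)) \<partial>std_normal_distribution)"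
    by (rule integral_norm_bound)
  also have "\<dots> \<le> (\<integral>t. e + 2 * indicator {t. R < \<bar>t\<bar>} t \<partial>std_normal_distribution)"
  proof (rule integral_mono)
    show "integrable std_normal_distribution (\<lambda>t. norm (1 - char M (s * t)))"
      using int_char by auto
    show "integrable std_normal_distribution (\<lambda>t. e + 2 * indicator {t. R < \<bar>t\<bar>} t)"
      using ind by auto
    fix t
    show "norm (1 - char M (s * t)) \<le> e + 2 * indicator {t. R < \<bar>t\<bar>} t"
    proof (cases "R < \<bar>t\<bar>")
      case True
      have "0 \<le> e"
        using near[of 0] \<open>0 < d\<close> by (simp add: char_zero)
      with True le2[of "s * t"] show ?thesis by simp
    next
      case False
      then have "\<bar>s * t\<bar> \<le> s * R"
        using \<open>0 < s\<close> by (simp add: abs_mult)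
      with near[of "s * t"] False show ?thesis
        by (simp add: s)
    qed
  qed
  also have "\<dots> = e + 2 * measure std_normal_distribution {t. R < \<bar>t\<bar>}"
    using ind N.prob_space by simp
  also have "\<dots> \<le> 3 * e"
    using tail by simp
  finally show ?thesis
    by (simp add: s_def)
qed

lemma tight_of_char_near_1:
  assumes G: "\<And>n. real_distribution (G n)"
    and near: "\<And>e. 0 < e \<Longrightarrow> \<exists>d>0. \<forall>n t. \<bar>t\<bar> \<le> d \<longrightarrow> norm (1 - char (G n) t) \<le> e"
  shows "tight G"
  unfolding tight_def
proof (intro conjI allI impI G)
  fix \<epsilon> :: real assume "0 < \<epsilon>"
  \<comment> \<open>The tail estimate loses a factor 6, so an eighth leaves a strict
    inequality.\<close>
  then have e: "0 < \<epsilon> / 8" by simp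
  obtain R where R: "0 < R" "measure std_normal_distribution {t. R < \<bar>t\<bar>} < \<epsilon> / 8"
    using real_distribution.small_tail[OF real_dist_normal_dist e] .
  obtain d where d: "0 < d" "\<And>n t. \<bar>t\<bar> \<le> d \<Longrightarrow> norm (1 - char (G n) t) \<le> \<epsilon> / 8"
    using near[OF e] by auto
  let ?r = "2 * R / d"
  have "1 - \<epsilon> < measure (G n) {-?r<..?r}" for n
  proof -
    interpret real_distribution "G n" by (rule G)
    have "measure (G n) {x. ?r \<le> \<bar>x\<bar>} \<le> 6 * (\<epsilon> / 8)"
      by (rule tail_le_of_char_near_1) (use R d in auto)
    moreover have "1 - measure (G n) {x. ?r \<le> \<bar>x\<bar>} = measure (G n) (UNIV - {x. ?r \<le> \<bar>x\<bar>})"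
      using prob_compl[of "{x. ?r \<le> \<bar>x\<bar>}"] by simp
    moreover have "\<dots> \<le> measure (G n) {-?r<..?r}"
      by (intro finite_measure_mono) auto
    ultimately show ?thesis
      using \<open>0 < \<epsilon>\<close> by linarith
  qed
  moreover have "- ?r < ?r"
    using R d by simp
  ultimately show "\<exists>a b. a < b \<and> (\<forall>n. 1 - \<epsilon> < measure (G n) {a<..b})"
    by blast
qed

section \<open>Limits of random sums\<close>

lemma phi_ID_law_of_random_sum_limit:
  fixes \<mu> :: "real measure" and X :: "real \<Rightarrow> nat \<Rightarrow> 'a \<Rightarrow> real"
  assumes \<mu>: "real_distribution \<mu>" and nonneg: "AE u in \<mu>. 0 \<le> u" and m: "1 \<le> m"
    and M: "\<And>\<theta>. 0 < \<theta> \<Longrightarrow> prob_space (M \<theta>)"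
    and N: "\<And>\<theta>. 0 < \<theta> \<Longrightarrow> N \<theta> \<in> measurable (M \<theta>) (count_space UNIV)"
    and pgf: "\<And>\<theta> s. 0 < \<theta> \<Longrightarrow> 0 < s \<Longrightarrow> s < 1 \<Longrightarrow> complex_of_real (pgf (M \<theta>) (N \<theta>) s) =
      complex_of_real s ^ j * laplace \<mu> (complex_of_real ((1 - s ^ m) / \<theta>))"
    and iid: "\<And>\<theta>. 0 < \<theta> \<Longrightarrow> iid_indep_of (M \<theta>) (N \<theta>) (X \<theta>)"
    and K: "tends_in_law_at_0 M (\<lambda>\<theta> \<omega>. \<Sum>i = 1..nat \<lfloor>1 / \<theta>\<rfloor>. X \<theta> i \<omega>) K"
    and L: "tends_in_law_at_0 M (\<lambda>\<theta> \<omega>. \<Sum>i = 1..N \<theta> \<omega>. X \<theta> i \<omega>) L"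
  shows "phi_ID_law (laplace \<mu>) L"
proof -
  \<comment> \<open>Along this sequence the integer part is exactly \<open>Suc n\<close>, so the
    non-random sums have characteristic function \<open>g n t ^ Suc n\<close>.\<close>
  define x where "x n = 1 / real (Suc n)" for n
  have x: "0 < x n" "nat \<lfloor>1 / x n\<rfloor> = Suc n" for n
    by (auto simp: x_def)
  have "x \<longlonglongrightarrow> 0"
    unfolding x_def using LIMSEQ_inverse_real_of_nat by (simp add: inverse_eq_divide)
  then have lim_x: "filterlim x (at_right 0) sequentially"
    using x(1) by (intro tendsto_imp_filterlim_at_right always_eventually) auto
  \<comment> \<open>Three values of \<open>k\<close> matter: 1 for the law of a summand,
    \<open>Suc n\<close> for the convergent non-random sum, and \<open>m\<close> for the witness in
    \<open>phi_ID\<close>, whose characteristic function is \<open>g n t ^ m\<close>.\<close>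
  define F where "F n k = distr (M (x n)) borel (\<lambda>\<omega>. \<Sum>i = 1..k. X (x n) i \<omega>)" for n k
  define R where "R n = distr (M (x n)) borel (\<lambda>\<omega>. \<Sum>i = 1..N (x n) \<omega>. X (x n) i \<omega>)" for n
  define g where "g n t = char (F n 1) t" for n t
  have F: "real_distribution (F n k)" for n k
    unfolding F_def by (intro prob_space.real_distribution_distr M x iid_indep_of_measurable_sum[OF M iid])
  have R: "real_distribution (R n)" for n
    unfolding R_def
    by (intro prob_space.real_distribution_distr M x iid_indep_of_measurable_random_sum[OF M iid N])
  have char_F: "char (F n k) t = g n t ^ k" for n k t
    using char_iid_sum[OF M[OF x(1)] iid[OF x(1)], of n k t] by (simp add: g_def F_def)
  have g_le: "norm (g n t) \<le> 1" for n t
    unfolding g_def by (rule real_distribution.cmod_char_le_1[OF F])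
  have K': "real_distribution K" and L': "real_distribution L"
    using K L by (auto simp: tends_in_law_at_0_def)
  have "weak_conv_m (\<lambda>n. F n (Suc n)) K"
    using tends_in_law_at_0_imp_weak_conv_m[OF K lim_x] by (simp add: x F_def)
  then have g_lim: "(\<lambda>n. g n t) \<longlonglongrightarrow> 1" for t
    unfolding g_def by (rule char_root_tendsto_1[OF F F K' _ filterlim_Suc char_F[unfolded g_def]])
  let ?s = "\<lambda>n t. complex_of_real (real (Suc n)) * (1 - g n t ^ m)"
  have char_R: "char (R n) t = g n t ^ j * laplace \<mu> (?s n t)" for n t
  proof -
    have "char (R n) t = (\<integral>\<omega>. g n t ^ N (x n) \<omega> \<partial>M (x n))"
      using char_random_sum[OF M[OF x(1)] iid[OF x(1)] N[OF x(1)], of n t]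
      by (simp add: R_def g_def F_def)
    also have "\<dots> = g n t ^ j * laplace \<mu> ((1 - g n t ^ m) / complex_of_real (x n))"
      by (rule pgf_complex_extension[OF \<mu> nonneg M[OF x(1)] N[OF x(1)] m x(1) pgf[OF x(1)] g_le])
    finally show ?thesis
      by (simp add: x_def field_simps)
  qed
  have bounded: "norm (laplace \<mu> (?s n t)) \<le> 1" for n t
  proof (rule norm_laplace_le_1[OF \<mu> nonneg])
    have "norm (g n t ^ m) \<le> 1"
      using g_le by (simp add: norm_power power_le_one)
    then have "Re (g n t ^ m) \<le> 1"
      using complex_Re_le_cmod[of "g n t ^ m"] by linarith
    then show "0 \<le> Re (?s n t)"
      by simp
  qed
  have "(\<lambda>n. laplace \<mu> (?s n t)) \<longlonglongrightarrow> char L t" for t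
  proof -
    have "weak_conv_m R L"
      unfolding R_def by (rule tends_in_law_at_0_imp_weak_conv_m[OF L lim_x])
    then have "(\<lambda>n. char (R n) t) \<longlonglongrightarrow> char L t"
      by (rule levy_continuity1[OF R L'])
    \<comment> \<open>The arguments \<open>?s n t\<close> may be unbounded, but the Laplace
      transform is bounded by 1, so removing \<open>g n t ^ j\<close> costs a vanishing
      amount.\<close>
    moreover have "(\<lambda>n. (g n t ^ j - 1) * laplace \<mu> (?s n t)) \<longlonglongrightarrow> 0"
    proof (rule Lim_null_comparison)
      have "(\<lambda>n. norm (g n t ^ j - 1)) \<longlonglongrightarrow> norm (1 ^ j - 1 :: complex)"
        by (intro tendsto_intros g_lim)
      then show "(\<lambda>n. norm (g n t ^ j - 1)) \<longlonglongrightarrow> 0"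
        by simp
      show "\<forall>\<^sub>F n in sequentially. norm ((g n t ^ j - 1) * laplace \<mu> (?s n t)) \<le> norm (g n t ^ j - 1)"
        using bounded by (intro always_eventually) (auto simp: norm_mult intro!: mult_left_le)
    qed
    ultimately have "(\<lambda>n. char (R n) t - (g n t ^ j - 1) * laplace \<mu> (?s n t)) \<longlonglongrightarrow> char L t - 0"
      by (rule tendsto_diff)
    then show ?thesis
      by (simp add: char_R algebra_simps)
  qed
  then have "phi_ID (laplace \<mu>) (char L)"
    unfolding phi_ID_def
    by (intro exI[of _ "\<lambda>n. real (Suc n)"] exI[of _ "\<lambda>n. F n m"]) (auto simp: F char_F simp del: of_nat_Suc)
  with L' show ?thesis
    by (simp add: phi_ID_law_def)
qed

section \<open>Realising a law as a limit of random sums\<close>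

text \<open>\<open>n \<theta>\<close> is the largest \<open>k\<close> with
  \<open>\<theta> * (real k * B k) \<le> 1\<close>. The factor \<open>real k\<close> yields the
  error bound \<open>1 / n \<theta>\<close>; each fixed \<open>k\<close> is admissible for small
  \<theta>, so \<open>n \<theta>\<close> tends to infinity.\<close>

lemma ex_slow_index:
  fixes b :: "nat \<Rightarrow> real"
  shows "\<exists>n :: real \<Rightarrow> nat. filterlim n at_top (at_right 0) \<and> ((\<lambda>\<theta>. \<theta> * b (n \<theta>)) \<longlongrightarrow> 0) (at_right 0)"
proof -
  \<comment> \<open>The summand 1 forces admissible \<open>k\<close> to be at most
    \<open>1 / \<theta>\<close>, so that a greatest one exists.\<close>
  define B where "B k = 1 + (\<Sum>i\<le>k. \<bar>b i\<bar>)" for k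
  define P where "P \<theta> k \<longleftrightarrow> \<theta> * (real k * B k) \<le> 1" for \<theta> k
  define n where "n \<theta> = (GREATEST k. P \<theta> k)" for \<theta>
  have B1: "1 \<le> B k" for k
    unfolding B_def by (simp add: sum_nonneg)
  have b_le: "\<bar>b k\<bar> \<le> B k" for k
  proof -
    have "\<bar>b k\<bar> \<le> (\<Sum>i\<le>k. \<bar>b i\<bar>)"
      by (intro member_le_sum) auto
    then show ?thesis
      by (simp add: B_def)
  qed
  have P_le: "k \<le> nat \<lceil>1 / \<theta>\<rceil>" if "0 < \<theta>" "P \<theta> k" for \<theta> k
  proof -
    have "\<theta> * (real k * 1) \<le> \<theta> * (real k * B k)"
      using that B1 by (intro mult_left_mono) auto
    also have "\<dots> \<le> 1"
      using that by (simp add: P_def)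
    finally have "real k \<le> 1 / \<theta>"
      using that by (simp add: field_simps)
    then show ?thesis
      by (simp add: le_nat_iff) linarith
  qed
  have P0: "P \<theta> 0" for \<theta>
    by (simp add: P_def)
  have Pn: "P \<theta> (n \<theta>)" if "0 < \<theta>" for \<theta>
    unfolding n_def by (rule GreatestI_nat[of "P \<theta>", OF P0 P_le[OF that]])
  have le_n: "k \<le> n \<theta>" if "0 < \<theta>" "P \<theta> k" for \<theta> k
    unfolding n_def by (rule Greatest_le_nat[of "P \<theta>", OF that(2) P_le[OF that(1)]])
  have pos: "\<forall>\<^sub>F \<theta> :: real in at_right 0. 0 < \<theta>"
    by (simp add: eventually_at_right_less)
  have n_lim: "filterlim n at_top (at_right 0)"
    unfolding filterlim_at_top
  proof
    fix Z :: nat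
    have "((\<lambda>\<theta>. \<theta> * (real Z * B Z)) \<longlongrightarrow> 0) (at_right 0)"
      by (rule tendsto_mult_left_zero) (rule tendsto_ident_at)
    then have "\<forall>\<^sub>F \<theta> in at_right 0. \<theta> * (real Z * B Z) < 1"
      by (rule order_tendstoD(2)) simp
    with pos show "\<forall>\<^sub>F \<theta> in at_right 0. Z \<le> n \<theta>"
      by eventually_elim (auto intro!: le_n simp: P_def)
  qed
  have "((\<lambda>\<theta>. \<theta> * b (n \<theta>)) \<longlongrightarrow> 0) (at_right 0)"
  proof (rule Lim_null_comparison)
    show "((\<lambda>\<theta>. inverse (real (n \<theta>))) \<longlongrightarrow> 0) (at_right 0)"
      using filterlim_compose[OF lim_inverse_n n_lim] .
    have "\<forall>\<^sub>F \<theta> in at_right 0. 0 < n \<theta>"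
      using eventually_compose_filterlim[OF eventually_gt_at_top n_lim] .
    with pos show "\<forall>\<^sub>F \<theta> in at_right 0. norm (\<theta> * b (n \<theta>)) \<le> inverse (real (n \<theta>))"
    proof eventually_elim
      fix \<theta> :: real assume \<theta>: "0 < \<theta>" and n: "0 < n \<theta>"
      have "norm (\<theta> * b (n \<theta>)) \<le> \<theta> * B (n \<theta>)"
        using \<theta> b_le by (simp add: abs_mult)
      also have "\<dots> \<le> inverse (real (n \<theta>))"
        using Pn[OF \<theta>] n by (simp add: P_def field_simps)
      finally show "norm (\<theta> * b (n \<theta>)) \<le> inverse (real (n \<theta>))" .
    qed
  qed
  with n_lim show ?thesis by blast
qed

section \<open>Equicontinuity of the exponents\<close>

text \<open>The value 1 would make the real part of \<open>exp (- s * u)\<close> equal to 1 for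
  almost all \<open>u\<close>. At any \<open>u\<close> in (0, k) this forces \<open>Re s = 0\<close>
  and \<open>cos (r * u) = 1\<close>, which \<open>0 < r * u \<le> pi\<close> excludes.\<close>

lemma laplace_ne_1_on_small_circle:
  assumes \<mu>: "real_distribution \<mu>" and nonneg: "AE u in \<mu>. 0 \<le> u"
    and nondeg: "\<not> (AE u in \<mu>. u = 0)" and "0 < e"
  obtains r where "0 < r" "r \<le> e" "\<And>s. 0 \<le> Re s \<Longrightarrow> norm s = r \<Longrightarrow> laplace \<mu> s \<noteq> 1"
proof -
  interpret real_distribution \<mu> by fact
  \<comment> \<open>Some bounded interval (0, k) has positive mass; its length determines the
    admissible radii, \<open>r \<le> pi / real k\<close>.\<close>
  have "\<exists>k. \<not> (AE u in \<mu>. \<not> (0 < u \<and> u < real k))"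
  proof (rule ccontr)
    assume "\<not> ?thesis"
    then have "AE u in \<mu>. \<forall>k. \<not> (0 < u \<and> u < real k)"
      unfolding AE_all_countable by blast
    with nonneg have "AE u in \<mu>. u = 0"
    proof eventually_elim
      fix u :: real assume "0 \<le> u" "\<forall>k. \<not> (0 < u \<and> u < real k)"
      moreover obtain k where "u < real k"
        using reals_Archimedean2 by blast
      ultimately show "u = 0"
        by (metis order_le_less)
    qed
    with nondeg show False ..
  qed
  then obtain k where k: "\<not> (AE u in \<mu>. \<not> (0 < u \<and> u < real k))" by blast
  then have "0 < real k"
    by (cases k) auto
  define r where "r = min e (pi / real k)"
  have r: "0 < r" "r \<le> e" "r * real k \<le> pi"
    using \<open>0 < e\<close> \<open>0 < real k\<close> by (auto simp: r_def min_def field_simps)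
  have "laplace \<mu> s \<noteq> 1" if s: "0 \<le> Re s" "norm s = r" for s
  proof
    assume eq: "laplace \<mu> s = 1"
    let ?f = "\<lambda>u. Re (1 - exp (- (s * complex_of_real u)))"
    have int: "integrable \<mu> (\<lambda>u. 1 - exp (- (s * complex_of_real u)))"
      using integrable_laplace[OF \<mu> nonneg s(1)] by auto
    have "(\<integral>u. ?f u \<partial>\<mu>) = Re (\<integral>u. 1 - exp (- (s * complex_of_real u)) \<partial>\<mu>)"
      by (rule integral_Re[OF int])
    also have "(\<integral>u. 1 - exp (- (s * complex_of_real u)) \<partial>\<mu>) = 1 - laplace \<mu> s"
      unfolding laplace_def using prob_space
      by (subst Bochner_Integration.integral_diff[OF _ integrable_laplace[OF \<mu> nonneg s(1)]]) auto
    finally have int0: "(\<integral>u. ?f u \<partial>\<mu>) = 0"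
      using eq by simp
    have exp_le: "exp (- (Re s * u)) \<le> 1" if "0 \<le> u" for u
      using s that by simp
    have "AE u in \<mu>. 0 \<le> ?f u"
      using nonneg
    proof eventually_elim
      fix u :: real assume "0 \<le> u"
      then have "norm (exp (- (s * complex_of_real u))) \<le> 1"
        using exp_le by simp
      then have "Re (exp (- (s * complex_of_real u))) \<le> 1"
        by (rule order_trans[OF complex_Re_le_cmod])
      then show "0 \<le> ?f u"
        by simp
    qed
    with int0 have "AE u in \<mu>. ?f u = 0"
      using integral_nonneg_eq_0_iff_AE[OF integrable_Re[OF int]] by simp
    then have "AE u in \<mu>. \<not> (0 < u \<and> u < real k)"
    proof eventually_elim
      fix u :: real assume "?f u = 0"
      then have f: "exp (- (Re s * u)) * cos (Im s * u) = 1"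
        by (simp add: Re_exp)
      show "\<not> (0 < u \<and> u < real k)"
      proof safe
        assume u: "0 < u" "u < real k"
        have "1 \<le> exp (- (Re s * u))"
        proof -
          have "exp (- (Re s * u)) * cos (Im s * u) \<le> exp (- (Re s * u)) * 1"
            by (intro mult_left_mono) auto
          with f show ?thesis by simp
        qed
        then have "Re s * u \<le> 0"
          by simp
        then have Re: "Re s = 0"
          using s(1) u by (simp add: mult_le_0_iff)
        have "\<bar>Im s\<bar> = r"
          using s(2) Re by (simp add: cmod_def)
        then have "cos (Im s * u) = cos (r * u)"
          by (metis abs_if cos_minus mult_minus_left)
        also have "\<dots> < cos 0"
        proof (rule cos_monotone_0_pi)
          have "r * u \<le> r * real k"
            using r u by (intro mult_left_mono) auto
          then show "r * u \<le> pi"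
            using r(3) by linarith
        qed (use r u in auto)
        finally show False
          using f Re by simp
      qed
    qed
    with k show False ..
  qed
  with r show thesis
    using that by blast
qed

text \<open>The half circle is compact, so the continuous distance to 1, being positive there,
  attains a positive minimum.\<close>

lemma laplace_away_from_1_on_small_circle:
  assumes \<mu>: "real_distribution \<mu>" and nonneg: "AE u in \<mu>. 0 \<le> u"
    and nondeg: "\<not> (AE u in \<mu>. u = 0)" and "0 < e"
  obtains r \<eta> where "0 < r" "r \<le> e" "0 < \<eta>"
    "\<And>s. 0 \<le> Re s \<Longrightarrow> norm s = r \<Longrightarrow> \<eta> \<le> norm (1 - laplace \<mu> s)"
proof -
  obtain r where r: "0 < r" "r \<le> e" "\<And>s. 0 \<le> Re s \<Longrightarrow> norm s = r \<Longrightarrow> laplace \<mu> s \<noteq> 1"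
    using laplace_ne_1_on_small_circle[OF assms] by blast
  let ?C = "{s. 0 \<le> Re s} \<inter> sphere 0 r"
  have "compact ?C"
    by (intro closed_Int_compact closed_halfspace_Re_ge) simp
  moreover have "complex_of_real r \<in> ?C"
    using r by simp
  moreover have "continuous_on ?C (\<lambda>s. norm (1 - laplace \<mu> s))"
    by (intro continuous_on_norm continuous_on_diff continuous_on_const
        continuous_on_subset[OF continuous_on_laplace[OF \<mu> nonneg]]) auto
  ultimately obtain s where s: "s \<in> ?C" "\<And>s'. s' \<in> ?C \<Longrightarrow> norm (1 - laplace \<mu> s) \<le> norm (1 - laplace \<mu> s')"
    using continuous_attains_inf[of ?C] by blast
  show thesis
  proof (rule that[of r "norm (1 - laplace \<mu> s)"])
    show "0 < norm (1 - laplace \<mu> s)"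
      using s(1) r(3)[of s] by auto
  qed (use s r in auto)
qed

lemma Re_scaled_1_minus_char_nonneg:
  assumes "real_distribution F" "0 \<le> a"
  shows "0 \<le> Re (complex_of_real a * (1 - char F t))"
proof -
  have "Re (char F t) \<le> 1"
    using complex_Re_le_cmod[of "char F t"] real_distribution.cmod_char_le_1[OF assms(1), of t] by linarith
  then show ?thesis
    using assms(2) by simp
qed

text \<open>
  \<^term>\<open>laplace \<mu>\<close> may take the value 1 away from the origin, so its being close to 1 does not
  bound the argument. The argument depends continuously on \<^term>\<open>t\<close>, however, and starts
  at 0, so it cannot leave a disc on whose boundary \<^term>\<open>laplace \<mu>\<close> stays away from 1.
\<close>
lemma exponents_equicontinuous_at_0:
  assumes \<mu>: "real_distribution \<mu>" and nonneg: "AE u in \<mu>. 0 \<le> u"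
    and nondeg: "\<not> (AE u in \<mu>. u = 0)"
    and a: "\<And>n. 0 < a n" and F: "\<And>n. real_distribution (F n)" and L: "real_distribution L"
    and lim: "\<And>t. (\<lambda>n. laplace \<mu> (complex_of_real (a n) * (1 - char (F n) t))) \<longlonglongrightarrow> char L t"
    and "0 < e"
  shows "\<exists>d>0. \<forall>\<^sub>F n in sequentially. \<forall>t. \<bar>t\<bar> \<le> d \<longrightarrow> norm (complex_of_real (a n) * (1 - char (F n) t)) \<le> e"
proof -
  obtain r \<eta> where r: "0 < r" "r \<le> e" "0 < \<eta>"
    and \<eta>: "\<And>s. 0 \<le> Re s \<Longrightarrow> norm s = r \<Longrightarrow> \<eta> \<le> norm (1 - laplace \<mu> s)"
    using laplace_away_from_1_on_small_circle[OF \<mu> nonneg nondeg \<open>0 < e\<close>] by blast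
  \<comment> \<open>Realising these functions as characteristic functions of laws turns their
    pointwise convergence into weak convergence, and thus into closeness to 1 on a common
    neighbourhood of 0.\<close>
  have "\<forall>n. \<exists>G. real_distribution G \<and>
      (\<forall>t. char G t = laplace \<mu> (complex_of_real (a n) * (1 - char (F n) t)))"
    using ex_mixed_compound_Poisson[OF \<mu> nonneg F less_imp_le[OF a]] by blast
  then obtain G where G: "\<And>n. real_distribution (G n)"
    and char_G: "\<And>n t. char (G n) t = laplace \<mu> (complex_of_real (a n) * (1 - char (F n) t))"
    by metis
  have conv: "weak_conv_m G L"
    by (rule levy_continuity[OF G L]) (simp add: char_G lim)
  then obtain d where "0 < d"
    and d: "\<forall>\<^sub>F n in sequentially. \<forall>t. \<bar>t\<bar> \<le> d \<longrightarrow> norm (1 - char (G n) t) < \<eta>"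
    using weak_conv_m_char_near_1[OF G L conv r(3)] by blast
  from d have "\<forall>\<^sub>F n in sequentially. \<forall>t. \<bar>t\<bar> \<le> d \<longrightarrow> norm (complex_of_real (a n) * (1 - char (F n) t)) \<le> e"
  proof (eventually_elim, intro allI impI)
    fix n t
    assume n: "\<forall>t. \<bar>t\<bar> \<le> d \<longrightarrow> norm (1 - char (G n) t) < \<eta>" and t: "\<bar>t\<bar> \<le> d"
    have "norm (1 - char (F n) t) < r / a n"
    proof (rule real_distribution.norm_char_minus_1_lt_of_circle[OF F _ t])
      fix s assume s: "\<bar>s\<bar> \<le> d"
      show "norm (1 - char (F n) s) \<noteq> r / a n"
      proof
        assume "norm (1 - char (F n) s) = r / a n"
        then have "norm (complex_of_real (a n) * (1 - char (F n) s)) = r"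
          using a[of n] by (simp add: norm_mult)
        then have "\<eta> \<le> norm (1 - char (G n) s)"
          unfolding char_G using a[of n] by (intro \<eta> Re_scaled_1_minus_char_nonneg F) auto
        with n s show False by (meson not_less)
      qed
    qed (use r a in simp)
    then have "norm (complex_of_real (a n) * (1 - char (F n) t)) < r"
      unfolding norm_mult norm_of_real using a[of n] by (simp add: field_simps)
    with r show "norm (complex_of_real (a n) * (1 - char (F n) t)) \<le> e"
      by linarith
  qed
  with \<open>0 < d\<close> show ?thesis by blast
qed

text \<open>The finitely many exceptional indices are absorbed by shrinking \<open>d\<close>, since
  each single characteristic function is continuous at 0.\<close>

lemma tight_of_eventually_char_near_1:
  assumes G: "\<And>n. real_distribution (G n)"
    and near: "\<And>e. 0 < e \<Longrightarrow>
      \<exists>d>0. \<forall>\<^sub>F n in sequentially. \<forall>t. \<bar>t\<bar> \<le> d \<longrightarrow> norm (1 - char (G n) t) \<le> e"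
  shows "tight G"
proof (rule tight_of_char_near_1[OF G])
  fix e :: real assume "0 < e"
  from near[OF this] obtain d n0 where "0 < d"
    and d: "\<And>n t. n0 \<le> n \<Longrightarrow> \<bar>t\<bar> \<le> d \<Longrightarrow> norm (1 - char (G n) t) \<le> e"
    by (auto simp: eventually_sequentially)
  have "\<forall>\<^sub>F \<delta> in at_right 0. \<forall>t. \<bar>t\<bar> \<le> \<delta> \<longrightarrow> norm (1 - char (G n) t) \<le> e" for n
  proof -
    interpret real_distribution "G n" by (rule G)
    obtain \<delta> where "0 < \<delta>" and \<delta>: "\<And>t. \<bar>t\<bar> < \<delta> \<Longrightarrow> norm (char (G n) t - 1) < e"
      using isCont_char[of 0] \<open>0 < e\<close> unfolding continuous_at_eps_delta
      by (auto simp: dist_norm char_zero)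
    show ?thesis
    proof (rule eventually_at_rightI[OF _ \<open>0 < \<delta>\<close>], intro allI impI)
      fix \<delta>' t assume "\<delta>' \<in> {0<..<\<delta>}" "\<bar>t\<bar> \<le> \<delta>'"
      then show "norm (1 - char (G n) t) \<le> e"
        using \<delta>[of t] by (simp add: norm_minus_commute)
    qed
  qed
  then have "\<forall>\<^sub>F \<delta> in at_right 0. \<forall>n\<in>{..<n0}. \<forall>t. \<bar>t\<bar> \<le> \<delta> \<longrightarrow> norm (1 - char (G n) t) \<le> e"
    by (intro eventually_ball_finite) auto
  moreover have "\<forall>\<^sub>F \<delta> in at_right 0. 0 < \<delta> \<and> \<delta> < d"
    using eventually_at_right_real[OF \<open>0 < d\<close>] by eventually_elim auto
  ultimately have "\<forall>\<^sub>F \<delta> in at_right 0. 0 < \<delta> \<and> (\<forall>n t. \<bar>t\<bar> \<le> \<delta> \<longrightarrow> norm (1 - char (G n) t) \<le> e)"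
  proof eventually_elim
    fix \<delta> :: real
    assume 1: "\<forall>n\<in>{..<n0}. \<forall>t. \<bar>t\<bar> \<le> \<delta> \<longrightarrow> norm (1 - char (G n) t) \<le> e" and 2: "0 < \<delta> \<and> \<delta> < d"
    show "0 < \<delta> \<and> (\<forall>n t. \<bar>t\<bar> \<le> \<delta> \<longrightarrow> norm (1 - char (G n) t) \<le> e)"
    proof (intro conjI allI impI)
      fix n t assume "\<bar>t\<bar> \<le> \<delta>"
      with 1 2 d[of n t] show "norm (1 - char (G n) t) \<le> e"
        by (cases "n < n0") auto
    qed (use 2 in simp)
  qed
  then show "\<exists>d>0. \<forall>n t. \<bar>t\<bar> \<le> d \<longrightarrow> norm (1 - char (G n) t) \<le> e"
    using eventually_happens'[OF trivial_limit_at_right_real] by blast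
qed

text \<open>The derivative \<open>exp (- z) - 1\<close> is bounded by \<open>norm w\<close> on the
  half disc of radius \<open>norm w\<close>, which is convex and contains 0 and
  \<open>w\<close>.\<close>

lemma norm_exp_minus_remainder_le:
  fixes w :: complex
  assumes "0 \<le> Re w"
  shows "norm (1 - exp (- w) - w) \<le> (norm w)\<^sup>2"
proof -
  let ?S = "{z. 0 \<le> Re z} \<inter> cball 0 (norm w)"
  have "norm ((1 - exp (- w) - w) - (1 - exp (- 0) - 0)) \<le> norm w * norm (w - 0)"
  proof (rule field_differentiable_bound[of ?S])
    show "convex ?S"
      by (intro convex_Int convex_halfspace_Re_ge) auto
    fix z assume z: "z \<in> ?S"
    show "((\<lambda>z. 1 - exp (- z) - z) has_field_derivative (exp (- z) - 1)) (at z within ?S)"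
      by (auto intro!: derivative_eq_intros)
    have "norm (exp (- z) - exp 0) \<le> norm (- z - 0)"
      using z by (intro norm_exp_diff_le) auto
    then show "norm (exp (- z) - 1) \<le> norm w"
      using z by simp
  qed (use assms in auto)
  then show ?thesis
    by (simp add: power2_eq_square)
qed

text \<open>Equicontinuity of the exponents enters as the hypothesis \<open>near\<close>, so one
  construction serves for degenerate and nondegenerate \<open>\<mu>\<close> alike.\<close>

lemma ex_random_sums_tending_to:
  fixes \<mu> :: "real measure" and M :: "real \<Rightarrow> 'a measure" and N :: "real \<Rightarrow> 'a \<Rightarrow> nat"
  assumes \<mu>: "real_distribution \<mu>" and nonneg: "AE u in \<mu>. 0 \<le> u" and m: "1 \<le> m"
    and M: "\<And>\<theta>. 0 < \<theta> \<Longrightarrow> prob_space (M \<theta>)"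
    and N: "\<And>\<theta>. 0 < \<theta> \<Longrightarrow> N \<theta> \<in> measurable (M \<theta>) (count_space UNIV)"
    and pgf: "\<And>\<theta> s. 0 < \<theta> \<Longrightarrow> 0 < s \<Longrightarrow> s < 1 \<Longrightarrow> complex_of_real (pgf (M \<theta>) (N \<theta>) s) =
      complex_of_real s ^ j * laplace \<mu> (complex_of_real ((1 - s ^ m) / \<theta>))"
    and L: "real_distribution L" and a: "\<And>n. 0 < a n" and F: "\<And>n. real_distribution (F n)"
    and lim: "\<And>t. (\<lambda>n. laplace \<mu> (complex_of_real (a n) * (1 - char (F n) t))) \<longlonglongrightarrow> char L t"
    and near: "\<And>e. 0 < e \<Longrightarrow>
      \<exists>d>0. \<forall>\<^sub>F n in sequentially. \<forall>t. \<bar>t\<bar> \<le> d \<longrightarrow> norm (complex_of_real (a n) * (1 - char (F n) t)) \<le> e"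
  shows "\<exists>(M' :: real \<Rightarrow> ('a \<times> (nat \<Rightarrow> real)) measure)
           (\<pi> :: real \<Rightarrow> 'a \<times> (nat \<Rightarrow> real) \<Rightarrow> 'a)
           (X :: real \<Rightarrow> nat \<Rightarrow> 'a \<times> (nat \<Rightarrow> real) \<Rightarrow> real).
           (\<forall>\<theta>>0. prob_space (M' \<theta>) \<and>
                  \<pi> \<theta> \<in> measurable (M' \<theta>) (M \<theta>) \<and> distr (M' \<theta>) (M \<theta>) (\<pi> \<theta>) = M \<theta> \<and>
                  iid_indep_of (M' \<theta>) (N \<theta> \<circ> \<pi> \<theta>) (X \<theta>)) \<and>
           (\<exists>K. tends_in_law_at_0 M' (\<lambda>\<theta> \<omega>. \<Sum>i = 1..nat \<lfloor>1 / \<theta>\<rfloor>. X \<theta> i \<omega>) K) \<and>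
           tends_in_law_at_0 M' (\<lambda>\<theta> \<omega>. \<Sum>i = 1..(N \<theta> \<circ> \<pi> \<theta>) \<omega>. X \<theta> i \<omega>) L"
proof -
  define \<psi> where "\<psi> n t = complex_of_real (a n) * (1 - char (F n) t)" for n t
  have Re_\<psi>: "0 \<le> Re (\<psi> n t)" for n t
    unfolding \<psi>_def using a[of n] by (intro Re_scaled_1_minus_char_nonneg F) auto
  have Re_nonpos: "Re (- (complex_of_real x * \<psi> n t)) \<le> 0" if "0 \<le> x" for x n t
    using Re_\<psi>[of n t] that by simp
  have norm_\<psi>: "norm (\<psi> n t) \<le> 2 * a n" for n t
  proof -
    have "norm (1 - char (F n) t) \<le> 2"
      using norm_triangle_ineq4[of 1 "char (F n) t"] real_distribution.cmod_char_le_1[OF F, of n t] by simp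
    then have "a n * norm (1 - char (F n) t) \<le> a n * 2"
      using a[of n] by (intro mult_left_mono) auto
    then show ?thesis
      using a[of n] by (simp add: \<psi>_def norm_mult)
  qed
  have m0: "0 < real m"
    using m by simp

  \<comment> \<open>These laws approximate the non-random sums. The division by \<open>m\<close>
    compensates the power \<open>m\<close> in the generating function of \<open>N\<close>.\<close>
  have "\<forall>n. \<exists>G. real_distribution G \<and> (\<forall>t. char G t = exp (- (complex_of_real (1 / real m) * \<psi> n t)))"
  proof
    fix n
    show "\<exists>G. real_distribution G \<and> (\<forall>t. char G t = exp (- (complex_of_real (1 / real m) * \<psi> n t)))"
      using ex_compound_Poisson[OF F, of "a n / real m" n] a[of n] m0 by (simp add: \<psi>_def)
  qed
  then obtain G where G: "\<And>n. real_distribution (G n)" and char_G: "\<And>n t. char (G n) t = exp (- (complex_of_real (1 / real m) * \<psi> n t))"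
    by metis
  have "tight G"
  proof (rule tight_of_eventually_char_near_1[OF G])
    fix e :: real assume "0 < e"
    then obtain d where "0 < d" and d: "\<forall>\<^sub>F n in sequentially. \<forall>t. \<bar>t\<bar> \<le> d \<longrightarrow> norm (\<psi> n t) \<le> e"
      using near unfolding \<psi>_def by blast
    from d have "\<forall>\<^sub>F n in sequentially. \<forall>t. \<bar>t\<bar> \<le> d \<longrightarrow> norm (1 - char (G n) t) \<le> e"
    proof (eventually_elim, intro allI impI)
      fix n t assume n: "\<forall>t. \<bar>t\<bar> \<le> d \<longrightarrow> norm (\<psi> n t) \<le> e" and t: "\<bar>t\<bar> \<le> d"
      have "norm (exp 0 - exp (- (complex_of_real (1 / real m) * \<psi> n t))) \<le>
        norm (0 - - (complex_of_real (1 / real m) * \<psi> n t))"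
        by (intro norm_exp_diff_le Re_nonpos) simp_all
      also have "\<dots> = norm (\<psi> n t) / real m"
        by (simp add: norm_divide)
      also have "\<dots> \<le> norm (\<psi> n t)"
        using m by (simp add: divide_le_eq mult_le_cancel_left1)
      also have "\<dots> \<le> e"
        using n t by blast
      finally show "norm (1 - char (G n) t) \<le> e"
        by (simp add: char_G)
    qed
    with \<open>0 < d\<close> show "\<exists>d>0. \<forall>\<^sub>F n in sequentially. \<forall>t. \<bar>t\<bar> \<le> d \<longrightarrow> norm (1 - char (G n) t) \<le> e"
      by blast
  qed
  then obtain r K where r: "strict_mono r" and K: "real_distribution K" and conv: "weak_conv_m (G \<circ> id \<circ> r) K"
    using tight_imp_convergent_subsubsequence[OF _ strict_mono_id] by blast
  have lim_G: "(\<lambda>k. char (G (r k)) t) \<longlonglongrightarrow> char K t" for t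
    using levy_continuity1[OF _ K conv, of t] G by simp

  \<comment> \<open>The square of \<open>1 + a\<close> dominates both \<open>a\<close> and its
    square, so this one condition controls the first-order errors \<open>\<theta> * a\<close> and
    the second-order error \<open>\<theta> * a\<^sup>2\<close>.\<close>
  obtain k where k: "filterlim k at_top (at_right 0)"
    and slow: "((\<lambda>\<theta>. \<theta> * (1 + a (r (k \<theta>)))\<^sup>2) \<longlongrightarrow> 0) (at_right (0 :: real))"
    using ex_slow_index[of "\<lambda>k. (1 + a (r k))\<^sup>2"] by blast
  define i where "i \<theta> = r (k \<theta>)" for \<theta>
  have i: "filterlim i at_top (at_right 0)"
    unfolding i_def using filterlim_compose[OF filterlim_subseq[OF r] k] .
  have pos: "\<forall>\<^sub>F \<theta> :: real in at_right 0. 0 < \<theta>"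
    by (simp add: eventually_at_right_less)
  have slow_bound: "(f \<longlongrightarrow> 0) (at_right 0)"
    if "\<And>\<theta>. 0 < \<theta> \<Longrightarrow> norm (f \<theta>) \<le> 4 * (\<theta> * (1 + a (i \<theta>))\<^sup>2)" for f :: "real \<Rightarrow> complex"
  proof (rule Lim_null_comparison)
    show "((\<lambda>\<theta>. 4 * (\<theta> * (1 + a (i \<theta>))\<^sup>2)) \<longlongrightarrow> 0) (at_right 0)"
      using tendsto_mult_right_zero[OF slow] by (simp add: i_def)
    show "\<forall>\<^sub>F \<theta> in at_right 0. norm (f \<theta>) \<le> 4 * (\<theta> * (1 + a (i \<theta>))\<^sup>2)"
      using pos by eventually_elim (rule that)
  qed
  have sq_ge: "a n \<le> (1 + a n)\<^sup>2" "(a n)\<^sup>2 \<le> (1 + a n)\<^sup>2" for n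
    using a[of n] by (auto simp: power2_eq_square algebra_simps)

  have "\<forall>\<theta>. \<exists>H. 0 < \<theta> \<longrightarrow> real_distribution H \<and>
      (\<forall>t. char H t = exp (- (complex_of_real (\<theta> / real m) * \<psi> (i \<theta>) t)))"
  proof
    fix \<theta> :: real
    show "\<exists>H. 0 < \<theta> \<longrightarrow> real_distribution H \<and>
      (\<forall>t. char H t = exp (- (complex_of_real (\<theta> / real m) * \<psi> (i \<theta>) t)))"
      using ex_compound_Poisson[OF F, of "\<theta> / real m * a (i \<theta>)" "i \<theta>"] a[of "i \<theta>"] m0
      by (cases "0 < \<theta>") (simp_all add: \<psi>_def mult.assoc)
  qed
  then obtain H where H: "\<And>\<theta>. 0 < \<theta> \<Longrightarrow> real_distribution (H \<theta>)"
    and char_H: "\<And>\<theta> t. 0 < \<theta> \<Longrightarrow> char (H \<theta>) t = exp (- (complex_of_real (\<theta> / real m) * \<psi> (i \<theta>) t))"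
    by metis
  have char_H_power: "char (H \<theta>) t ^ n = exp (- (complex_of_real (real n * \<theta> / real m) * \<psi> (i \<theta>) t))"
    if "0 < \<theta>" for \<theta> t n
    by (simp add: char_H[OF that] exp_of_nat_mult[symmetric] mult_ac)
  have H_le: "norm (char (H \<theta>) t) \<le> 1" if "0 < \<theta>" for \<theta> t
    by (rule real_distribution.cmod_char_le_1[OF H[OF that]])

  define M' where "M' \<theta> = M \<theta> \<Otimes>\<^sub>M PiM (UNIV :: nat set) (\<lambda>_. H \<theta>)" for \<theta>
  define X where "X = (\<lambda>(\<theta> :: real) (l :: nat) (\<omega> :: 'a \<times> (nat \<Rightarrow> real)). snd \<omega> l)"
  note ext = M N H
  have P: "prob_space (M' \<theta>)" if "0 < \<theta>" for \<theta>
    unfolding M'_def by (rule prob_space_iid_extension[OF ext]) fact+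
  have iid: "iid_indep_of (M' \<theta>) (N \<theta> \<circ> fst) (X \<theta>)" if "0 < \<theta>" for \<theta>
    unfolding M'_def X_def by (rule iid_indep_of_iid_extension[OF ext]) fact+
  have distr_X: "distr (M' \<theta>) borel (X \<theta> l) = H \<theta>" if "0 < \<theta>" for \<theta> l
    unfolding M'_def X_def by (rule distr_coordinate_iid_extension[OF ext]) fact+
  have fst: "fst \<in> measurable (M' \<theta>) (M \<theta>)" for \<theta>
    unfolding M'_def by (rule measurable_fst)
  have distr_fst: "distr (M' \<theta>) (M \<theta>) fst = M \<theta>" if "0 < \<theta>" for \<theta>
    unfolding M'_def by (rule distr_fst_iid_extension[OF ext]) fact+
  have N': "N \<theta> \<circ> fst \<in> measurable (M' \<theta>) (count_space UNIV)" if "0 < \<theta>" for \<theta>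
    using measurable_comp[OF fst N[OF that]] .

  have "tends_in_law_at_0 M' (\<lambda>\<theta> \<omega>. \<Sum>l = 1..nat \<lfloor>1 / \<theta>\<rfloor>. X \<theta> l \<omega>) K"
  proof (rule tends_in_law_at_0I[OF P _ K])
    fix t
    let ?S = "\<lambda>\<theta>. distr (M' \<theta>) borel (\<lambda>\<omega>. \<Sum>l = 1..nat \<lfloor>1 / \<theta>\<rfloor>. X \<theta> l \<omega>)"
    have "((\<lambda>\<theta>. char (G (i \<theta>)) t) \<longlongrightarrow> char K t) (at_right 0)"
      unfolding i_def using filterlim_compose[OF lim_G k] .
    moreover have "((\<lambda>\<theta>. char (?S \<theta>) t - char (G (i \<theta>)) t) \<longlongrightarrow> 0) (at_right 0)"
    proof (rule slow_bound)
      fix \<theta> :: real assume \<theta>: "0 < \<theta>"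
      \<comment> \<open>The sum has exponent \<open>c * \<psi> / m\<close> instead of
        \<open>\<psi> / m\<close>, and rounding moves \<open>c\<close> from 1 by at most
        \<theta>.\<close>
      define c where "c = real (nat \<lfloor>1 / \<theta>\<rfloor>) * \<theta>"
      have "real (nat \<lfloor>1 / \<theta>\<rfloor>) = of_int \<lfloor>1 / \<theta>\<rfloor>"
        using \<theta> by simp
      then have "real (nat \<lfloor>1 / \<theta>\<rfloor>) \<le> 1 / \<theta>" "1 / \<theta> \<le> real (nat \<lfloor>1 / \<theta>\<rfloor>) + 1"
        by linarith+
      then have "c \<le> 1 / \<theta> * \<theta>" "1 / \<theta> * \<theta> \<le> (real (nat \<lfloor>1 / \<theta>\<rfloor>) + 1) * \<theta>"
        unfolding c_def using \<theta> by (intro mult_right_mono; simp)+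
      then have "c \<le> 1" "1 \<le> c + \<theta>"
        using \<theta> by (simp_all add: c_def distrib_right)
      then have c: "0 \<le> c" "\<bar>1 - c\<bar> \<le> \<theta>"
        using \<theta> by (simp_all add: c_def)
      have "char (?S \<theta>) t = exp (- (complex_of_real (c / real m) * \<psi> (i \<theta>) t))"
        using char_iid_sum[OF P[OF \<theta>] iid[OF \<theta>], of "nat \<lfloor>1 / \<theta>\<rfloor>" t]
        unfolding distr_X[OF \<theta>] char_H_power[OF \<theta>] c_def .
      then have "norm (char (?S \<theta>) t - char (G (i \<theta>)) t) \<le>
        norm (- (complex_of_real (c / real m) * \<psi> (i \<theta>) t) - - (complex_of_real (1 / real m) * \<psi> (i \<theta>) t))"
        using c(1) by (simp only: char_G) (intro norm_exp_diff_le Re_nonpos; simp)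
      also have "\<dots> = norm (complex_of_real ((1 - c) / real m) * \<psi> (i \<theta>) t)"
        by (rule arg_cong[of _ _ norm]) (simp add: diff_divide_distrib algebra_simps)
      also have "\<dots> = \<bar>1 - c\<bar> / real m * norm (\<psi> (i \<theta>) t)"
        unfolding norm_mult norm_of_real by simp
      also have "\<dots> \<le> \<theta> * (2 * a (i \<theta>))"
      proof (intro mult_mono norm_\<psi>)
        have "\<bar>1 - c\<bar> / real m \<le> \<bar>1 - c\<bar> / 1"
          using m by (intro divide_left_mono) auto
        with c(2) show "\<bar>1 - c\<bar> / real m \<le> \<theta>" by simp
      qed (use \<theta> in auto)
      also have "\<dots> \<le> 4 * (\<theta> * (1 + a (i \<theta>))\<^sup>2)"
        using mult_left_mono[OF sq_ge(1)[of "i \<theta>"], of \<theta>] a[of "i \<theta>"] \<theta> by simp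
      finally show "norm (char (?S \<theta>) t - char (G (i \<theta>)) t) \<le> 4 * (\<theta> * (1 + a (i \<theta>))\<^sup>2)" .
    qed
    ultimately show "((\<lambda>\<theta>. char (?S \<theta>) t) \<longlongrightarrow> char K t) (at_right 0)"
      by (rule Lim_transform)
  qed (assumption, rule iid_indep_of_measurable_sum[OF P iid])

  moreover have "tends_in_law_at_0 M' (\<lambda>\<theta> \<omega>. \<Sum>l = 1..(N \<theta> \<circ> fst) \<omega>. X \<theta> l \<omega>) L"
  proof (rule tends_in_law_at_0I[OF P _ L])
    fix t
    let ?S = "\<lambda>\<theta>. distr (M' \<theta>) borel (\<lambda>\<omega>. \<Sum>l = 1..(N \<theta> \<circ> fst) \<omega>. X \<theta> l \<omega>)"
    let ?g = "\<lambda>\<theta>. char (H \<theta>) t"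
    let ?s = "\<lambda>\<theta>. (1 - ?g \<theta> ^ m) / complex_of_real \<theta>"
    have char_S: "char (?S \<theta>) t = ?g \<theta> ^ j * laplace \<mu> (?s \<theta>)" if \<theta>: "0 < \<theta>" for \<theta>
    proof -
      have "char (?S \<theta>) t = (\<integral>\<omega>. ?g \<theta> ^ (N \<theta> \<circ> fst) \<omega> \<partial>M' \<theta>)"
        using char_random_sum[OF P[OF \<theta>] iid[OF \<theta>] N'[OF \<theta>], of t] unfolding distr_X[OF \<theta>] .
      also have "\<dots> = (\<integral>\<omega>. ?g \<theta> ^ N \<theta> \<omega> \<partial>distr (M' \<theta>) (M \<theta>) fst)"
        using N[OF \<theta>] fst by (subst integral_distr) (auto intro: measurable_compose)
      also have "\<dots> = ?g \<theta> ^ j * laplace \<mu> (?s \<theta>)"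
        unfolding distr_fst[OF \<theta>]
        by (rule pgf_complex_extension[OF \<mu> nonneg M[OF \<theta>] N[OF \<theta>] m \<theta> pgf[OF \<theta>] H_le[OF \<theta>]])
      finally show ?thesis .
    qed
    have Re_s: "0 \<le> Re (?s \<theta>)" if \<theta>: "0 < \<theta>" for \<theta>
    proof -
      have "norm (?g \<theta> ^ m) \<le> 1"
        using H_le[OF \<theta>] by (simp add: norm_power power_le_one)
      then have "Re (?g \<theta> ^ m) \<le> 1"
        using complex_Re_le_cmod[of "?g \<theta> ^ m"] by linarith
      then show ?thesis
        using \<theta> by simp
    qed
    \<comment> \<open>\<open>?g \<theta> ^ m\<close> is \<open>exp (- \<theta> * \<psi>)\<close>, so
      the difference is the Taylor remainder of order 2 divided by \<theta>, of size at most
      \<open>\<theta> * (norm \<psi>)\<^sup>2\<close>.\<close>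
    have "((\<lambda>\<theta>. ?s \<theta> - \<psi> (i \<theta>) t) \<longlongrightarrow> 0) (at_right 0)"
    proof (rule slow_bound)
      fix \<theta> :: real assume \<theta>: "0 < \<theta>"
      let ?w = "complex_of_real \<theta> * \<psi> (i \<theta>) t"
      have "?s \<theta> - \<psi> (i \<theta>) t = (1 - exp (- ?w) - ?w) / complex_of_real \<theta>"
        using \<theta> m0 by (simp add: char_H_power[OF \<theta>] field_simps)
      also have "norm \<dots> = norm (1 - exp (- ?w) - ?w) / \<theta>"
        using \<theta> by (simp add: norm_divide)
      also have "\<dots> \<le> (norm ?w)\<^sup>2 / \<theta>"
        using \<theta> Re_\<psi>[of "i \<theta>" t] by (intro divide_right_mono norm_exp_minus_remainder_le) auto
      also have "\<dots> = \<theta> * (norm (\<psi> (i \<theta>) t))\<^sup>2"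
        using \<theta> by (simp add: norm_mult power2_eq_square)
      also have "\<dots> \<le> \<theta> * (2 * a (i \<theta>))\<^sup>2"
        using \<theta> by (intro mult_left_mono power_mono norm_\<psi>) auto
      also have "\<dots> \<le> 4 * (\<theta> * (1 + a (i \<theta>))\<^sup>2)"
        using mult_left_mono[OF sq_ge(2)[of "i \<theta>"], of \<theta>] \<theta> by (simp add: power_mult_distrib)
      finally show "norm (?s \<theta> - \<psi> (i \<theta>) t) \<le> 4 * (\<theta> * (1 + a (i \<theta>))\<^sup>2)" .
    qed
    then have "((\<lambda>\<theta>. laplace \<mu> (?s \<theta>) - laplace \<mu> (\<psi> (i \<theta>) t)) \<longlongrightarrow> 0) (at_right 0)"
    proof (rule tendsto_laplace_diff[OF \<mu> nonneg])
      show "\<forall>\<^sub>F \<theta> in at_right 0. 0 \<le> Re (?s \<theta>)"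
        using pos by eventually_elim (rule Re_s)
    qed (use Re_\<psi> in simp)
    moreover have "((\<lambda>\<theta>. laplace \<mu> (\<psi> (i \<theta>) t)) \<longlongrightarrow> char L t) (at_right 0)"
      using filterlim_compose[OF lim i] by (simp add: \<psi>_def)
    ultimately have lim_laplace: "((\<lambda>\<theta>. laplace \<mu> (?s \<theta>)) \<longlongrightarrow> char L t) (at_right 0)"
      by (rule Lim_transform[rotated])
    have "((\<lambda>\<theta>. ?g \<theta> - 1) \<longlongrightarrow> 0) (at_right 0)"
    proof (rule slow_bound)
      fix \<theta> :: real assume \<theta>: "0 < \<theta>"
      have "norm (?g \<theta> - exp 0) \<le> norm (- (complex_of_real (\<theta> / real m) * \<psi> (i \<theta>) t) - 0)"
        unfolding char_H[OF \<theta>] using \<theta> by (intro norm_exp_diff_le Re_nonpos) simp_all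
      also have "\<dots> = \<theta> / real m * norm (\<psi> (i \<theta>) t)"
        using \<theta> by (simp add: norm_mult norm_divide)
      also have "\<dots> \<le> \<theta> * (2 * a (i \<theta>))"
      proof (intro mult_mono norm_\<psi>)
        have "\<theta> / real m \<le> \<theta> / 1"
          using m \<theta> by (intro divide_left_mono) auto
        then show "\<theta> / real m \<le> \<theta>" by simp
      qed (use \<theta> in auto)
      also have "\<dots> \<le> 4 * (\<theta> * (1 + a (i \<theta>))\<^sup>2)"
        using mult_left_mono[OF sq_ge(1)[of "i \<theta>"], of \<theta>] a[of "i \<theta>"] \<theta> by simp
      finally show "norm (?g \<theta> - 1) \<le> 4 * (\<theta> * (1 + a (i \<theta>))\<^sup>2)"
        by simp
    qed
    then have "((\<lambda>\<theta>. ?g \<theta> ^ j) \<longlongrightarrow> 1 ^ j) (at_right 0)"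
      by (intro tendsto_power) (simp add: LIM_zero_iff)
    then have "((\<lambda>\<theta>. ?g \<theta> ^ j * laplace \<mu> (?s \<theta>)) \<longlongrightarrow> 1 ^ j * char L t) (at_right 0)"
      using lim_laplace by (rule tendsto_mult)
    moreover have "\<forall>\<^sub>F \<theta> in at_right 0. ?g \<theta> ^ j * laplace \<mu> (?s \<theta>) = char (?S \<theta>) t"
      using pos by eventually_elim (rule char_S[symmetric])
    ultimately show "((\<lambda>\<theta>. char (?S \<theta>) t) \<longlongrightarrow> char L t) (at_right 0)"
      by (simp add: tendsto_cong)
  qed (assumption, rule iid_indep_of_measurable_random_sum[OF P iid N'])

  ultimately show ?thesis
    using P iid fst distr_fst
    by (intro exI[of _ M'] exI[of _ "\<lambda>_. fst"] exI[of _ X] conjI exI[of _ K] allI impI) auto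
qed

section \<open>Both directions combined, with the degenerate mixing law treated separately\<close>

theorem theorem2p8:
  fixes \<mu> :: "real measure" and j m :: nat
    and M :: "real \<Rightarrow> 'a measure" and N :: "real \<Rightarrow> 'a \<Rightarrow> nat"
  assumes "real_distribution \<mu>" and "AE u in \<mu>. 0 \<le> u"
    and "1 \<le> m"
    and "\<And>\<theta>. 0 < \<theta> \<Longrightarrow> prob_space (M \<theta>)"
    and "\<And>\<theta>. 0 < \<theta> \<Longrightarrow> N \<theta> \<in> measurable (M \<theta>) (count_space UNIV)"
    and "\<And>\<theta> s. 0 < \<theta> \<Longrightarrow> 0 < s \<Longrightarrow> s < 1 \<Longrightarrow>
           complex_of_real (pgf (M \<theta>) (N \<theta>) s) =
             complex_of_real s ^ j * laplace \<mu> (complex_of_real ((1 - s ^ m) / \<theta>))"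
  shows
    "(\<forall>(X :: real \<Rightarrow> nat \<Rightarrow> 'a \<Rightarrow> real) (L :: real measure).
        (\<forall>\<theta>>0. iid_indep_of (M \<theta>) (N \<theta>) (X \<theta>)) \<longrightarrow>
        (\<exists>K. tends_in_law_at_0 M (\<lambda>\<theta> \<omega>. \<Sum>i = 1..nat \<lfloor>1 / \<theta>\<rfloor>. X \<theta> i \<omega>) K) \<longrightarrow>
        tends_in_law_at_0 M (\<lambda>\<theta> \<omega>. \<Sum>i = 1..N \<theta> \<omega>. X \<theta> i \<omega>) L \<longrightarrow>
        phi_ID_law (laplace \<mu>) L)
     \<and>
     (\<forall>L :: real measure. phi_ID_law (laplace \<mu>) L \<longrightarrow>
        (\<exists>(M' :: real \<Rightarrow> ('a \<times> (nat \<Rightarrow> real)) measure)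
           (\<pi> :: real \<Rightarrow> 'a \<times> (nat \<Rightarrow> real) \<Rightarrow> 'a)
           (X :: real \<Rightarrow> nat \<Rightarrow> 'a \<times> (nat \<Rightarrow> real) \<Rightarrow> real).
           (\<forall>\<theta>>0. prob_space (M' \<theta>) \<and>
                  \<pi> \<theta> \<in> measurable (M' \<theta>) (M \<theta>) \<and> distr (M' \<theta>) (M \<theta>) (\<pi> \<theta>) = M \<theta> \<and>
                  iid_indep_of (M' \<theta>) (N \<theta> \<circ> \<pi> \<theta>) (X \<theta>)) \<and>
           (\<exists>K. tends_in_law_at_0 M' (\<lambda>\<theta> \<omega>. \<Sum>i = 1..nat \<lfloor>1 / \<theta>\<rfloor>. X \<theta> i \<omega>) K) \<and>
           tends_in_law_at_0 M' (\<lambda>\<theta> \<omega>. \<Sum>i = 1..(N \<theta> \<circ> \<pi> \<theta>) \<omega>. X \<theta> i \<omega>) L))"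
proof (intro conjI allI impI)
  fix X :: "real \<Rightarrow> nat \<Rightarrow> 'a \<Rightarrow> real" and L :: "real measure"
  assume iid: "\<forall>\<theta>>0. iid_indep_of (M \<theta>) (N \<theta>) (X \<theta>)"
    and "\<exists>K. tends_in_law_at_0 M (\<lambda>\<theta> \<omega>. \<Sum>i = 1..nat \<lfloor>1 / \<theta>\<rfloor>. X \<theta> i \<omega>) K"
    and L: "tends_in_law_at_0 M (\<lambda>\<theta> \<omega>. \<Sum>i = 1..N \<theta> \<omega>. X \<theta> i \<omega>) L"
  then obtain K where K: "tends_in_law_at_0 M (\<lambda>\<theta> \<omega>. \<Sum>i = 1..nat \<lfloor>1 / \<theta>\<rfloor>. X \<theta> i \<omega>) K"
    by blast
  show "phi_ID_law (laplace \<mu>) L"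
    by (rule phi_ID_law_of_random_sum_limit[OF assms iid[rule_format] K L])
next
  fix L :: "real measure"
  assume "phi_ID_law (laplace \<mu>) L"
  then obtain a F where L: "real_distribution L" and a: "\<And>n. 0 < a n" and F: "\<And>n. real_distribution (F n)"
    and lim: "\<And>t. (\<lambda>n. laplace \<mu> (complex_of_real (a n) * (1 - char (F n) t))) \<longlonglongrightarrow> char L t"
    unfolding phi_ID_law_def phi_ID_def by blast
  \<comment> \<open>Adds equicontinuity of the exponents at 0 to the data of a \<phi>-ID law; the
    sequences may be changed to obtain it.\<close>
  let ?conv = "\<lambda>(a :: nat \<Rightarrow> real) (F :: nat \<Rightarrow> real measure).
    (\<forall>n. 0 < a n) \<and> (\<forall>n. real_distribution (F n)) \<and>
    (\<forall>t. (\<lambda>n. laplace \<mu> (complex_of_real (a n) * (1 - char (F n) t))) \<longlonglongrightarrow> char L t) \<and>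
    (\<forall>e>0. \<exists>d>0. \<forall>\<^sub>F n in sequentially. \<forall>t. \<bar>t\<bar> \<le> d \<longrightarrow> norm (complex_of_real (a n) * (1 - char (F n) t)) \<le> e)"
  have "\<exists>a F. ?conv a F"
  proof (cases "AE u in \<mu>. u = 0")
    case True
    interpret real_distribution \<mu> by fact
    have laplace_1: "laplace \<mu> s = 1" for s
    proof -
      have "laplace \<mu> s = (\<integral>u. 1 \<partial>\<mu>)"
        unfolding laplace_def
      proof (rule integral_cong_AE)
        show "AE u in \<mu>. exp (- (s * complex_of_real u)) = 1"
          using True by eventually_elim simp
      qed auto
      then show ?thesis
        using prob_space by simp
    qed
    have dirac: "real_distribution (return borel (0 :: real))"
      by (simp add: real_distribution_def real_distribution_axioms_def prob_space_return)
    have char_dirac: "char (return borel 0) t = 1" for t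
      unfolding char_def by (subst integral_return) auto
    \<comment> \<open>Here the Laplace transform is constantly 1 and says nothing about the given
      exponents. They are replaced by zero exponents, which have the same limit
      \<open>char L t\<close>.\<close>
    have "?conv (\<lambda>_. 1) (\<lambda>_. return borel 0)"
    proof (intro conjI allI impI)
      show "(\<lambda>_. laplace \<mu> (complex_of_real 1 * (1 - char (return borel 0) t))) \<longlonglongrightarrow> char L t" for t
        using lim[of t] by (simp only: laplace_1)
      show "\<exists>d>0. \<forall>\<^sub>F n in sequentially. \<forall>t. \<bar>t\<bar> \<le> d \<longrightarrow>
          norm (complex_of_real 1 * (1 - char (return borel 0) t)) \<le> e" if "0 < e" for e
        using that by (intro exI[of _ 1]) (simp add: char_dirac)
    qed (simp_all add: dirac)
    then show ?thesis
      by (intro exI)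
  next
    case False
    have "?conv a F"
      by (intro conjI allI impI a F lim exponents_equicontinuous_at_0[OF assms(1,2) False a F L lim])
    then show ?thesis
      by (intro exI)
  qed
  then obtain a F where conv: "?conv a F"
    by (elim exE)
  show "\<exists>(M' :: real \<Rightarrow> ('a \<times> (nat \<Rightarrow> real)) measure)
           (\<pi> :: real \<Rightarrow> 'a \<times> (nat \<Rightarrow> real) \<Rightarrow> 'a)
           (X :: real \<Rightarrow> nat \<Rightarrow> 'a \<times> (nat \<Rightarrow> real) \<Rightarrow> real).
           (\<forall>\<theta>>0. prob_space (M' \<theta>) \<and>
                  \<pi> \<theta> \<in> measurable (M' \<theta>) (M \<theta>) \<and> distr (M' \<theta>) (M \<theta>) (\<pi> \<theta>) = M \<theta> \<and>
                  iid_indep_of (M' \<theta>) (N \<theta> \<circ> \<pi> \<theta>) (X \<theta>)) \<and>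
           (\<exists>K. tends_in_law_at_0 M' (\<lambda>\<theta> \<omega>. \<Sum>i = 1..nat \<lfloor>1 / \<theta>\<rfloor>. X \<theta> i \<omega>) K) \<and>
           tends_in_law_at_0 M' (\<lambda>\<theta> \<omega>. \<Sum>i = 1..(N \<theta> \<circ> \<pi> \<theta>) \<omega>. X \<theta> i \<omega>) L"
    by (rule ex_random_sums_tending_to[OF assms L, where a = a and F = F]) (use conv in simp_all)
qed

end
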